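(* Let $f\in C^1[0,1]$, $f\not\equiv0$, satisfy $f(0)=f(1)=0$ and $f\ge0$ on $(0,1)$. Then there exists a constant $C>0$ that depends on $f$ but not on $T_0$ or $u$ such that the following holds. Let $u(y)\in C^1[0,H]$ satisfy $\int_0^Hu(y)\,dy=0$, and let $T(x,y,t)$ solve $$T_t+u(y)T_x=\kappa\Delta T+\frac{v_0^2}{\kappa}f(T)\ \text{ in }\Omega=\mathbb R\times[0,H],\qquad T(x,y,0)=T_0(x,y),$$ with $T\to1$ as $x\to-\infty$, $T\to0$ as $x\to+\infty$, and either Neumann or periodic boundary conditions in $y$, where the initial data satisfies $$\kappa\Delta T_0-u(y)\frac{\partial T_0}{\partial x}+\frac{v_0^2}{\kappa}f(T_0)\ge0$$ and, for some $\lambda>0$, $T_0=1-O(e^{\lambda x})$ for $x<0$, $T_0=O(e^{-\lambda x})$ for $x>0$, $|\nabla T_0|=O(e^{-\lambda|x|})$. Then for any collection of intervals $I_j=(c_j-h_j,c_j+h_j)\subset[0,H]$ such that $$\frac{\|u\|_{\infty,j}}{2}\le|u(y)|\le\|u\|_{\infty,j}\ \text{ for }y\in I_j,\qquad\|u\|_{\infty,j}=\sup_{I_j}|u(y)|,$$ one has for all $t>0$ $$V(t)\ge C\left(v_0+\sum_j\left(1+\frac{l}{h_j}\right)^{-1}\int_{c_j-h_j}^{c_j+h_j}|u(y)|\frac{dy}{H}\right),\qquad l=\frac{\kappa}{v_0}.$$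
   Context: $\kappa,v_0,H>0$ are constants. Neumann conditions: $T_y(x,0,t)=T_y(x,H,t)=0$. Periodic conditions: $T(x,y+H,t)=T(x,y,t)$. The temperature satisfies $0\le T\le1$. The differential inequality on $T_0$ guarantees $T_t\ge0$ for all times by the maximum principle. The bulk burning rate is $V(t)=\int_\Omega T_t(x,y,t)\frac{dx\,dy}{H}$. It is not required that $\bigcup_jI_j=[0,H]$.
   Formalization: The intervals I_j are required to be pairwise disjoint, since repeating or nesting intervals would make the sum arbitrarily large while V(t) stays finite; the boundary conditions are taken to hold at t=0 too, hence for T_0. *)

theory Defs
  imports "HOL-Analysis.Analysis"
begin

definition C1_on :: "real \<Rightarrow> real \<Rightarrow> (real \<Rightarrow> real) \<Rightarrow> bool" where
  "C1_on a b g \<longleftrightarrow>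
     (\<exists>g'. continuous_on {a..b} g' \<and>
        (\<forall>y\<in>{a..b}. (g has_real_derivative g' y) (at y within {a..b})))"

text \<open>
  Partial derivatives of a function on the closed strip \<open>UNIV \<times> {0..H}\<close>. The
  \<open>y\<close>-derivative is taken within \<open>{0..H}\<close>, hence is one-sided on the boundary and never
  depends on values outside the strip.
\<close>

definition Dx :: "(real \<Rightarrow> real \<Rightarrow> real) \<Rightarrow> real \<Rightarrow> real \<Rightarrow> real" where
  "Dx g x y = deriv (\<lambda>s. g s y) x"

definition Dy :: "real \<Rightarrow> (real \<Rightarrow> real \<Rightarrow> real) \<Rightarrow> real \<Rightarrow> real \<Rightarrow> real" where
  "Dy H g x y = vector_derivative (g x) (at y within {0..H})"

definition laplacian :: "real \<Rightarrow> (real \<Rightarrow> real \<Rightarrow> real) \<Rightarrow> real \<Rightarrow> real \<Rightarrow> real" where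
  "laplacian H g x y = Dx (Dx g) x y + Dy H (Dy H g) x y"

definition twice_differentiable_strip :: "real \<Rightarrow> (real \<Rightarrow> real \<Rightarrow> real) \<Rightarrow> bool" where
  "twice_differentiable_strip H g \<longleftrightarrow>
     (\<forall>x. \<forall>y\<in>{0..H}.
        (\<lambda>s. g s y) differentiable (at x) \<and>
        (\<lambda>s. Dx g s y) differentiable (at x) \<and>
        g x differentiable (at y within {0..H}) \<and>
        Dy H g x differentiable (at y within {0..H}))"

text \<open>Mixed second derivatives do not enter the equation and are not required to exist.\<close>

definition C2_strip :: "real \<Rightarrow> (real \<Rightarrow> real \<Rightarrow> real) \<Rightarrow> bool" where
  "C2_strip H g \<longleftrightarrow>
     twice_differentiable_strip H g \<and>
     continuous_on (UNIV \<times> {0..H}) (\<lambda>(x, y). g x y) \<and>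
     continuous_on (UNIV \<times> {0..H}) (\<lambda>(x, y). Dx g x y) \<and>
     continuous_on (UNIV \<times> {0..H}) (\<lambda>(x, y). Dy H g x y) \<and>
     continuous_on (UNIV \<times> {0..H}) (\<lambda>(x, y). Dx (Dx g) x y) \<and>
     continuous_on (UNIV \<times> {0..H}) (\<lambda>(x, y). Dy H (Dy H g) x y)"

text \<open>
  Regularity of a classical solution \<open>T x y t\<close>: continuous up to \<open>t = 0\<close>, once continuously
  differentiable in time and twice in each space variable for \<open>t > 0\<close>, up to the boundary
  of the strip.
\<close>

definition classical_regularity :: "real \<Rightarrow> (real \<Rightarrow> real \<Rightarrow> real \<Rightarrow> real) \<Rightarrow> bool" where
  "classical_regularity H T \<longleftrightarrow>
     continuous_on (UNIV \<times> {0..H} \<times> {0..}) (\<lambda>(x, y, t). T x y t) \<and>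
     (\<forall>t>0. twice_differentiable_strip H (\<lambda>x y. T x y t)) \<and>
     (\<forall>x. \<forall>y\<in>{0..H}. \<forall>t>0. T x y differentiable (at t)) \<and>
     continuous_on (UNIV \<times> {0..H} \<times> {0<..}) (\<lambda>(x, y, t). deriv (T x y) t) \<and>
     continuous_on (UNIV \<times> {0..H} \<times> {0<..}) (\<lambda>(x, y, t). Dx (\<lambda>x y. T x y t) x y) \<and>
     continuous_on (UNIV \<times> {0..H} \<times> {0<..}) (\<lambda>(x, y, t). Dy H (\<lambda>x y. T x y t) x y) \<and>
     continuous_on (UNIV \<times> {0..H} \<times> {0<..}) (\<lambda>(x, y, t). Dx (Dx (\<lambda>x y. T x y t)) x y) \<and>
     continuous_on (UNIV \<times> {0..H} \<times> {0<..}) (\<lambda>(x, y, t). Dy H (Dy H (\<lambda>x y. T x y t)) x y)"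

definition neumann_bc :: "real \<Rightarrow> (real \<Rightarrow> real \<Rightarrow> real \<Rightarrow> real) \<Rightarrow> bool" where
  "neumann_bc H T \<longleftrightarrow>
     (\<forall>x. \<forall>t\<ge>0. Dy H (\<lambda>x y. T x y t) x 0 = 0 \<and> Dy H (\<lambda>x y. T x y t) x H = 0)"

text \<open>
  Differentiability of the periodic extension on the whole line makes the \<open>y\<close>-derivatives
  match at \<open>y = 0\<close> and \<open>y = H\<close>. The second derivatives are not required to match, since
  \<open>u 0 = u H\<close> is not assumed.
\<close>

definition periodic_bc :: "real \<Rightarrow> (real \<Rightarrow> real \<Rightarrow> real \<Rightarrow> real) \<Rightarrow> bool" where
  "periodic_bc H T \<longleftrightarrow>
     (\<forall>x. \<forall>t\<ge>0. (\<forall>y. T x (y + H) t = T x y t) \<and> (\<lambda>y. T x y t) differentiable_on UNIV)"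

text \<open>
  Both boundary conditions include \<open>t = 0\<close>, so they also constrain the initial data.
\<close>

definition reactive_solution ::
  "real \<Rightarrow> real \<Rightarrow> real \<Rightarrow> (real \<Rightarrow> real) \<Rightarrow> (real \<Rightarrow> real) \<Rightarrow> (real \<Rightarrow> real \<Rightarrow> real)
   \<Rightarrow> (real \<Rightarrow> real \<Rightarrow> real \<Rightarrow> real) \<Rightarrow> bool" where
  "reactive_solution \<kappa> v0 H f u T0 T \<longleftrightarrow>
     classical_regularity H T \<and>
     (\<forall>x. \<forall>y\<in>{0..H}. \<forall>t\<ge>0. 0 \<le> T x y t \<and> T x y t \<le> 1) \<and>
     (\<forall>x. \<forall>y\<in>{0..H}. \<forall>t>0.
        deriv (T x y) t + u y * Dx (\<lambda>x y. T x y t) x y =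
          \<kappa> * laplacian H (\<lambda>x y. T x y t) x y + v0\<^sup>2 / \<kappa> * f (T x y t)) \<and>
     (\<forall>x. \<forall>y\<in>{0..H}. T x y 0 = T0 x y) \<and>
     (\<forall>y\<in>{0..H}. \<forall>t\<ge>0. ((\<lambda>x. T x y t) \<longlongrightarrow> 1) at_bot \<and> ((\<lambda>x. T x y t) \<longlongrightarrow> 0) at_top) \<and>
     (neumann_bc H T \<or> periodic_bc H T)"

definition admissible_initial_data ::
  "real \<Rightarrow> real \<Rightarrow> real \<Rightarrow> (real \<Rightarrow> real) \<Rightarrow> (real \<Rightarrow> real) \<Rightarrow> (real \<Rightarrow> real \<Rightarrow> real) \<Rightarrow> bool" where
  "admissible_initial_data \<kappa> v0 H f u T0 \<longleftrightarrow>
     C2_strip H T0 \<and>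
     (\<forall>x. \<forall>y\<in>{0..H}.
        \<kappa> * laplacian H T0 x y - u y * Dx T0 x y + v0\<^sup>2 / \<kappa> * f (T0 x y) \<ge> 0) \<and>
     (\<exists>lam>0. \<exists>M.
        (\<forall>x<0. \<forall>y\<in>{0..H}. \<bar>1 - T0 x y\<bar> \<le> M * exp (lam * x)) \<and>
        (\<forall>x>0. \<forall>y\<in>{0..H}. \<bar>T0 x y\<bar> \<le> M * exp (- lam * x)) \<and>
        (\<forall>x. \<forall>y\<in>{0..H}. sqrt ((Dx T0 x y)\<^sup>2 + (Dy H T0 x y)\<^sup>2) \<le> M * exp (- lam * \<bar>x\<bar>)))"

definition bulk_burning_rate :: "real \<Rightarrow> (real \<Rightarrow> real \<Rightarrow> real \<Rightarrow> real) \<Rightarrow> real \<Rightarrow> real" where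
  "bulk_burning_rate H T t =
     set_lebesgue_integral lborel (UNIV \<times> {0..H}) (\<lambda>(x, y). deriv (T x y) t / H)"

text \<open>
  A finite or countable family of open intervals \<open>I j = {c j - h j <..< c j + h j}\<close> for
  \<open>j \<in> J\<close>. The intervals are disjoint: otherwise one interval could be counted
  arbitrarily often in the sum over \<open>j\<close>. Since they are also nonempty and open, countable
  index sets give no loss of generality.
\<close>

definition admissible_intervals ::
  "real \<Rightarrow> (real \<Rightarrow> real) \<Rightarrow> nat set \<Rightarrow> (nat \<Rightarrow> real) \<Rightarrow> (nat \<Rightarrow> real) \<Rightarrow> bool" where
  "admissible_intervals H u J c h \<longleftrightarrow>
     disjoint_family_on (\<lambda>j. {c j - h j<..<c j + h j}) J \<and>
     (\<forall>j\<in>J. h j > 0 \<and> {c j - h j<..<c j + h j} \<subseteq> {0..H} \<and>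
        (let unorm = (SUP y\<in>{c j - h j<..<c j + h j}. \<bar>u y\<bar>) in
           \<forall>y\<in>{c j - h j<..<c j + h j}. unorm / 2 \<le> \<bar>u y\<bar> \<and> \<bar>u y\<bar> \<le> unorm))"

end

theory Submission
  imports Defs
begin

text \<open>
  Comparison with the stationary subsolution \<open>T0\<close> gives \<open>T \<ge> T0\<close>, hence (comparing \<open>T\<close> with its
  time shifts) \<open>T\<^sub>t \<ge> 0\<close>; an exponential supersolution controls the right tail, so the
  total reaction is finite. At a fixed time put \<open>w = T\<^sub>t + (v0\<^sup>2/\<kappa>) f(T) + \<kappa> \<bar>\<nabla>T\<bar>\<^sup>2\<close>.
  Testing the equation with \<open>1\<close> and with \<open>T\<close> shows \<open>\<integral>w \<le> 3 H V\<close>. Testing it with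
  \<open>\<phi>(y) f(T)\<close>, where \<open>\<phi>\<close> is a parabola vanishing at the ends of \<open>I\<^sub>j\<close>, turns advection into
  \<open>(\<integral>\<^sub>0\<^sup>1 f) \<integral>\<phi> u\<close>, while all other terms are pointwise at most \<open>const (1 + l/h\<^sub>j) w\<close> on
  \<open>\<real> \<times> I\<^sub>j\<close>: the cross term \<open>\<kappa> \<phi>' f(T) T\<^sub>y\<close> is absorbed by AM-GM because \<open>f\<^sup>2 \<le> const f\<close>.
  Summing over the disjoint strips gives the advective bound; AM-GM applied to
  \<open>f(T) T\<^sub>x\<close> gives \<open>V \<ge> const v0\<close>.
\<close>

text \<open>Testing with the weight \<phi>(y) alone would already produce an advective term, but it
  leaves \<kappa> \<phi>' T_y, and the dissipation controls only the square of the gradient on a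
  strip of infinite length. The factor f(T) concentrates the test function on the front, where the
  reaction density is itself integrable; this is what makes the AM-GM step possible. The comparison
  arguments enter the estimates only qualitatively, through signs and finiteness: the tail constants
  depend on \<open>T0\<close>, \<open>u\<close> and \<open>t\<close> and disappear again. Every
  quantitative step uses a bound \<open>M \<ge> 1\<close> on f and \<bar>f'\<bar> together with a
  primitive \<open>G\<close> of f. Hence C = (G 1 - G 0) / (10 M) depends on f alone. Here 10 = 1 +
  9: the 1 belongs to the laminar part, and 9 = 3 * 3 is the loss from replacing \<bar>u\<bar> by
  its parabolic average times the factor in \<integral>w \<le> 3 H V. Since no decay of the gradient
  is available for positive times, the integral identities are limits along specially chosen
  rectangles.\<close>

section \<open>The minimum principle on the strip\<close>

text \<open>
  What Neumann and periodic boundary conditions have in common: the boundary terms of the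
  integrations by parts cancel, and the derivative vanishes at a minimum located at an end.
\<close>

definition matching_ends :: "real \<Rightarrow> (real \<Rightarrow> real) \<Rightarrow> (real \<Rightarrow> real) \<Rightarrow> bool" where
  "matching_ends H p p' \<longleftrightarrow> (p' 0 = 0 \<and> p' H = 0) \<or> (p 0 = p H \<and> p' 0 = p' H)"

text \<open>If \<open>d\<close> were negative, \<open>p'\<close> would be negative just to the right
  of \<open>y0\<close>, or positive just to the left when \<open>y0\<close> is the right end, and
  the mean value theorem would give a smaller value of \<open>p\<close>. At an end of the interval a
  minimum does not force \<open>p' y0 = 0\<close>, so this is a hypothesis.\<close>

lemma second_derivative_nonneg_at_min:
  fixes p p' :: "real \<Rightarrow> real"
  assumes "a < b" and y0: "y0 \<in> {a..b}"
    and p: "\<And>y. y \<in> {a..b} \<Longrightarrow> (p has_real_derivative p' y) (at y within {a..b})"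
    and p': "(p' has_real_derivative d) (at y0 within {a..b})"
    and crit: "p' y0 = 0"
    and min: "\<And>y. y \<in> {a..b} \<Longrightarrow> p y0 \<le> p y"
  shows "0 \<le> d"
proof (rule ccontr)
  assume "\<not> 0 \<le> d"
  then have d: "d < 0" by simp
  have mvt: "\<exists>z\<in>{r<..<s}. p s - p r = (s - r) * p' z" if "r < s" "a \<le> r" "s \<le> b" for r s
  proof -
    have "(p has_derivative (\<lambda>h. h * p' y)) (at y within {r..s})" if "r \<le> y" "y \<le> s" for y
      using DERIV_subset[OF p[of y], of "{r..s}"] that \<open>a \<le> r\<close> \<open>s \<le> b\<close>
      by (auto simp: has_field_derivative_def mult.commute[of _ "p' y"])
    from mvt_simple[OF \<open>r < s\<close> this] show ?thesis by auto
  qed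
  show False
  proof (cases "y0 < b")
    case True
    obtain e where e: "e > 0" "\<And>h. 0 < h \<Longrightarrow> y0 + h \<in> {a..b} \<Longrightarrow> h < e \<Longrightarrow> p' (y0 + h) < 0"
      using has_real_derivative_neg_dec_right[OF p' d] crit by metis
    define h where "h = min (e/2) (b - y0)"
    have h: "0 < h" "h < e" "y0 + h \<le> b" using e True by (auto simp: h_def min_def)
    obtain z where z: "z \<in> {y0<..<y0+h}" "p (y0+h) - p y0 = h * p' z"
      using mvt[of y0 "y0+h"] h y0 by auto
    have "p' z < 0" using e(2)[of "z - y0"] z h y0 by auto
    then have "h * p' z < 0" using h by (simp add: mult_pos_neg)
    with z min[of "y0+h"] h y0 show False by auto
  next
    case False
    then have yb: "y0 = b" using y0 by auto
    obtain e where e: "e > 0" "\<And>h. 0 < h \<Longrightarrow> y0 - h \<in> {a..b} \<Longrightarrow> h < e \<Longrightarrow> p' (y0 - h) > 0"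
      using has_real_derivative_neg_dec_left[OF p' d] crit by metis
    define h where "h = min (e/2) (b - a)"
    have h: "0 < h" "h < e" "a \<le> y0 - h" using e \<open>a < b\<close> yb by (auto simp: h_def min_def)
    obtain z where z: "z \<in> {y0-h<..<y0}" "p y0 - p (y0-h) = h * p' z"
      using mvt[of "y0-h" y0] h yb by auto
    have "p' z > 0" using e(2)[of "y0 - z"] z h y0 by auto
    then have "h * p' z > 0" using h by simp
    with z min[of "y0-h"] h y0 show False by auto
  qed
qed

lemma derivative_sign_at_min:
  fixes p p' :: "real \<Rightarrow> real"
  assumes y0: "y0 \<in> {a..b}"
    and p: "(p has_real_derivative d) (at y0 within {a..b})"
    and min: "\<And>y. y \<in> {a..b} \<Longrightarrow> p y0 \<le> p y"
  shows "y0 < b \<Longrightarrow> 0 \<le> d" and "a < y0 \<Longrightarrow> d \<le> 0"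
proof -
  show "0 \<le> d" if "y0 < b"
  proof (rule ccontr)
    assume "\<not> 0 \<le> d"
    then obtain e where e: "e > 0" "\<And>h. 0 < h \<Longrightarrow> y0 + h \<in> {a..b} \<Longrightarrow> h < e \<Longrightarrow> p (y0 + h) < p y0"
      using has_real_derivative_neg_dec_right[OF p] by fastforce
    define h where "h = min (e/2) (b - y0)"
    have h: "0 < h" "h < e" "y0 + h \<le> b" using e that by (auto simp: h_def min_def)
    with e(2)[of h] min[of "y0+h"] y0 show False by auto
  qed
  show "d \<le> 0" if "a < y0"
  proof (rule ccontr)
    assume "\<not> d \<le> 0"
    then obtain e where e: "e > 0" "\<And>h. 0 < h \<Longrightarrow> y0 - h \<in> {a..b} \<Longrightarrow> h < e \<Longrightarrow> p (y0 - h) < p y0"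
      using has_real_derivative_pos_inc_left[OF p] by fastforce
    define h where "h = min (e/2) (y0 - a)"
    have h: "0 < h" "h < e" "y0 - h \<ge> a" using e that by (auto simp: h_def min_def)
    with e(2)[of h] min[of "y0-h"] y0 show False by auto
  qed
qed

text \<open>In the periodic case a minimum at one end is a minimum at both, so the one-sided signs
  give \<open>0 \<le> p' 0 = p' H \<le> 0\<close>.\<close>

lemma derivative_zero_at_min_matching_ends:
  assumes "0 < H" and y0: "y0 \<in> {0..H}"
    and p: "\<And>y. y \<in> {0..H} \<Longrightarrow> (p has_real_derivative p' y) (at y within {0..H})"
    and bc: "matching_ends H p p'"
    and min: "\<And>y. y \<in> {0..H} \<Longrightarrow> p y0 \<le> p y"
  shows "p' y0 = 0"
proof (cases "0 < y0 \<and> y0 < H")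
  case True
  then show ?thesis using derivative_sign_at_min[OF y0 p[OF y0] min] by force
next
  case False
  then have end_y0: "y0 = 0 \<or> y0 = H" using y0 by auto
  show ?thesis
  proof (cases "p' 0 = 0 \<and> p' H = 0")
    case True
    then show ?thesis using end_y0 by auto
  next
    case False
    then have per: "p 0 = p H" "p' 0 = p' H" using bc by (auto simp: matching_ends_def)
    then have min0: "p 0 \<le> p y" "p H \<le> p y" if "y \<in> {0..H}" for y using min end_y0 that by auto
    have "0 \<le> p' 0" using derivative_sign_at_min(1)[of 0 0 H, OF _ p min0(1)] \<open>0 < H\<close> by auto
    moreover have "p' H \<le> 0" using derivative_sign_at_min(2)[of H 0 H, OF _ p min0(2)] \<open>0 < H\<close> by auto
    ultimately show ?thesis using per end_y0 by auto
  qed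
qed

text \<open>
  The barrier \<open>\<epsilon> exp(\<Lambda> t) (1 + x\<^sup>2)\<close> confines the first zero of \<open>w\<close> plus barrier to a compact
  set. The barrier does not depend on \<open>y\<close>, so that \<open>w\<close> itself is minimal in \<open>y\<close> there.
\<close>

lemma strip_minimum_principle:
  fixes w wt wx wxx wy wyy :: "real \<Rightarrow> real \<Rightarrow> real \<Rightarrow> real"
  assumes "0 < H" "0 < \<kappa>" "0 \<le> L"
    and cont: "continuous_on (UNIV \<times> {0..H} \<times> {0..\<tau>}) (\<lambda>(x, y, t). w x y t)"
    and below: "\<And>x y t. y \<in> {0..H} \<Longrightarrow> t \<in> {0..\<tau>} \<Longrightarrow> - B \<le> w x y t"
    and init: "\<And>x y. y \<in> {0..H} \<Longrightarrow> 0 \<le> w x y 0"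
    and dt: "\<And>x y t. y \<in> {0..H} \<Longrightarrow> 0 < t \<Longrightarrow> t \<le> \<tau> \<Longrightarrow> (w x y has_real_derivative wt x y t) (at t)"
    and dx: "\<And>x y t. y \<in> {0..H} \<Longrightarrow> 0 < t \<Longrightarrow> t \<le> \<tau> \<Longrightarrow>
               ((\<lambda>s. w s y t) has_real_derivative wx x y t) (at x)"
    and dxx: "\<And>x y t. y \<in> {0..H} \<Longrightarrow> 0 < t \<Longrightarrow> t \<le> \<tau> \<Longrightarrow>
               ((\<lambda>s. wx s y t) has_real_derivative wxx x y t) (at x)"
    and dy: "\<And>x y t. y \<in> {0..H} \<Longrightarrow> 0 < t \<Longrightarrow> t \<le> \<tau> \<Longrightarrow>
               ((\<lambda>s. w x s t) has_real_derivative wy x y t) (at y within {0..H})"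
    and dyy: "\<And>x y t. y \<in> {0..H} \<Longrightarrow> 0 < t \<Longrightarrow> t \<le> \<tau> \<Longrightarrow>
               ((\<lambda>s. wy x s t) has_real_derivative wyy x y t) (at y within {0..H})"
    and bc: "\<And>x t. 0 < t \<Longrightarrow> t \<le> \<tau> \<Longrightarrow> matching_ends H (\<lambda>y. w x y t) (\<lambda>y. wy x y t)"
    and u: "\<And>y. y \<in> {0..H} \<Longrightarrow> \<bar>u y\<bar> \<le> U"
    and super: "\<And>x y t. y \<in> {0..H} \<Longrightarrow> 0 < t \<Longrightarrow> t \<le> \<tau> \<Longrightarrow> w x y t < 0 \<Longrightarrow>
        \<kappa> * (wxx x y t + wyy x y t) - u y * wx x y t + L * w x y t \<le> wt x y t"
    and y1: "y1 \<in> {0..H}" and t1: "t1 \<in> {0..\<tau>}"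
  shows "0 \<le> w x1 y1 t1"
proof (rule ccontr)
  assume "\<not> 0 \<le> w x1 y1 t1"
  then have neg: "w x1 y1 t1 < 0" by simp
  \<comment> \<open>The time derivative of the barrier has to beat the advection of
    \<open>1 + x\<^sup>2\<close> (rate \<open>U\<close>, as
    \<open>2 * \<bar>x\<bar> \<le> 1 + x\<^sup>2\<close>), its diffusion
    (\<open>2 * \<kappa>\<close>) and the zeroth-order term (\<open>L\<close>). The extra 1 makes
    the inequality strict.\<close>
  define \<Lambda> where "\<Lambda> = U + 2 * \<kappa> + L + 1"
  \<comment> \<open>Calibrated so that \<open>Z\<close> below vanishes at the point where
    \<open>w\<close> is negative; thus the set where \<open>Z \<le> 0\<close> is nonempty.\<close>
  define e where "e = - w x1 y1 t1 / (exp (\<Lambda> * t1) * (1 + x1\<^sup>2))"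
  have pos1: "0 < 1 + x\<^sup>2" for x :: real by (simp add: add_pos_nonneg)
  have e: "0 < e" unfolding e_def using neg pos1[of x1] by (intro divide_pos_pos mult_pos_pos) auto
  define Z where "Z x y t = w x y t + e * (exp (\<Lambda> * t) * (1 + x\<^sup>2))" for x y t
  have U0: "0 \<le> U" using u[OF y1] by linarith
  have \<Lambda>0: "0 < \<Lambda>" using U0 assms(2,3) by (simp add: \<Lambda>_def)
  have Z1: "Z x1 y1 t1 \<le> 0" using pos1[of x1] by (simp add: Z_def e_def)
  have contZ: "continuous_on (UNIV \<times> {0..H} \<times> {0..\<tau>}) (\<lambda>(x, y, t). Z x y t)"
    unfolding Z_def case_prod_beta
    using cont[unfolded case_prod_beta] by (intro continuous_intros)
  \<comment> \<open>Since \<open>w \<ge> - B\<close>, \<open>Z \<le> 0\<close> forces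
    \<open>1 + x\<^sup>2 \<le> B / e\<close>.\<close>
  define K where "K = {-(B/e)..B/e} \<times> {0..H} \<times> {0..\<tau>}"
  have inK: "(x, y, t) \<in> K" if "y \<in> {0..H}" "t \<in> {0..\<tau>}" "Z x y t \<le> 0" for x y t
  proof -
    have "1 \<le> exp (\<Lambda> * t)" using \<Lambda>0 that by auto
    then have "1 * (1 + x\<^sup>2) \<le> exp (\<Lambda> * t) * (1 + x\<^sup>2)"
      using pos1[of x] by (intro mult_right_mono) auto
    then have "e * (1 + x\<^sup>2) \<le> e * (exp (\<Lambda> * t) * (1 + x\<^sup>2))"
      using e by (intro mult_left_mono) auto
    then have "e * (1 + x\<^sup>2) \<le> B" using that(3) below[OF that(1,2), of x] by (simp add: Z_def)
    then have "1 + x\<^sup>2 \<le> B / e" using e by (simp add: field_simps)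
    moreover have "\<bar>x\<bar> \<le> 1 + x\<^sup>2"
      using zero_le_power2[of "\<bar>x\<bar> - 1"] by (simp add: power2_diff) 
    ultimately show ?thesis using that by (auto simp: K_def)
  qed
  define S where "S = K \<inter> (\<lambda>(x, y, t). Z x y t) -` {..0}"
  have "compact K" unfolding K_def by (intro compact_Times compact_Icc)
  have "compact S"
  proof -
    have "closed S" unfolding S_def
      by (rule continuous_closed_preimage)
        (use compact_imp_closed[OF \<open>compact K\<close>] in
          \<open>auto intro: continuous_on_subset[OF contZ] simp: K_def\<close>)
    then show ?thesis using compact_Int_closed[OF \<open>compact K\<close>, of S] by (simp add: S_def Int_absorb1)
  qed
  moreover have "S \<noteq> {}" using inK[OF y1 t1 Z1] Z1 by (auto simp: S_def)
  moreover have "continuous_on S (\<lambda>p. snd (snd p))" by (intro continuous_intros)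
  ultimately obtain p where p: "p \<in> S" "\<And>q. q \<in> S \<Longrightarrow> snd (snd p) \<le> snd (snd q)"
    using continuous_attains_inf[of S "\<lambda>p. snd (snd p)"] by blast
  obtain x0 y0 t0 where p0: "p = (x0, y0, t0)" by (cases p) auto
  have y0: "y0 \<in> {0..H}" and t0': "t0 \<in> {0..\<tau>}" and Z0': "Z x0 y0 t0 \<le> 0"
    using p(1) by (auto simp: p0 S_def K_def)
  have before: "0 < Z x y t" if "y \<in> {0..H}" "t \<in> {0..\<tau>}" "t < t0" for x y t
    using p(2)[of "(x,y,t)"] inK[OF that(1,2), of x] that by (force simp: p0 S_def)
  have "t0 \<noteq> 0"
  proof
    assume "t0 = 0"
    then have "e * (1 + x0\<^sup>2) \<le> 0" using Z0' init[OF y0, of x0] by (simp add: Z_def)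
    then show False using e pos1[of x0] by (simp add: mult_le_0_iff)
  qed
  then have t0: "0 < t0" "t0 \<le> \<tau>" using t0' by auto
  \<comment> \<open>By continuity from earlier times, so that \<open>(x0, y0)\<close> is a minimum
    over the whole time slice and the spatial derivative tests apply.\<close>
  have at_t0: "0 \<le> Z x y t0" if "y \<in> {0..H}" for x y
  proof -
    have c: "continuous_on (closure {0..<t0}) (\<lambda>t. Z x y t)"
    proof -
      have "continuous_on {0..t0} (\<lambda>t. (\<lambda>(x, y, t). Z x y t) (x, y, t))"
        by (rule continuous_on_compose2[OF contZ]) (use that t0 in \<open>auto intro!: continuous_intros\<close>)
      then show ?thesis using t0 by (simp add: closure_atLeastLessThan)
    qed
    show ?thesis
      by (rule continuous_ge_on_closure[OF c])
        (use t0 that before in \<open>auto simp: closure_atLeastLessThan intro!: less_imp_le\<close>)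
  qed
  have Z0: "Z x0 y0 t0 = 0" using Z0' at_t0[OF y0, of x0] by auto
  define E where "E = e * exp (\<Lambda> * t0)"
  have E: "0 < E" using e by (simp add: E_def)
  have w0: "w x0 y0 t0 = - (E * (1 + x0\<^sup>2))" using Z0 by (simp add: Z_def E_def)
  have w0neg: "w x0 y0 t0 < 0" unfolding w0 using E pos1[of x0] by simp
  \<comment> \<open>Positivity of \<open>Z\<close> is known only before \<open>t0\<close>, so the
    minimum in time is at the right end of \<open>{0..t0}\<close>, which yields one sign.\<close>
  have "wt x0 y0 t0 + E * \<Lambda> * (1 + x0\<^sup>2) \<le> 0"
  proof (rule derivative_sign_at_min(2)[of t0 0 t0 "\<lambda>t. Z x0 y0 t"])
    show "((\<lambda>t. Z x0 y0 t) has_real_derivative wt x0 y0 t0 + E * \<Lambda> * (1 + x0\<^sup>2)) (at t0 within {0..t0})"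
      unfolding Z_def E_def
      by (rule derivative_eq_intros DERIV_subset[OF dt[OF y0 t0]] refl | simp)+
    show "Z x0 y0 t0 \<le> Z x0 y0 t" if "t \<in> {0..t0}" for t
      using before[OF y0, of t x0] that t0 Z0 by (cases "t = t0") auto
  qed (use t0 in auto)
  then have wt: "wt x0 y0 t0 \<le> - (E * \<Lambda> * (1 + x0\<^sup>2))" by simp
  have dZx: "((\<lambda>s. Z s y0 t0) has_real_derivative wx x y0 t0 + E * (2 * x)) (at x)" for x
    unfolding Z_def E_def
    by (rule derivative_eq_intros dx[OF y0 t0] refl | simp)+
  have wx: "wx x0 y0 t0 + E * (2 * x0) = 0"
    by (rule DERIV_local_min[OF dZx, of 1]) (use at_t0[OF y0] Z0 in auto)
  have wxx: "0 \<le> wxx x0 y0 t0 + 2 * E"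
  proof (rule second_derivative_nonneg_at_min[where a="x0-1" and b="x0+1" and p="\<lambda>s. Z s y0 t0"])
    show "((\<lambda>s. Z s y0 t0) has_real_derivative wx x y0 t0 + E * (2 * x)) (at x within {x0-1..x0+1})" for x
      by (rule has_field_derivative_at_within[OF dZx])
    show "((\<lambda>x. wx x y0 t0 + E * (2 * x)) has_real_derivative wxx x0 y0 t0 + 2 * E) (at x0 within {x0-1..x0+1})"
      by (rule derivative_eq_intros has_field_derivative_at_within[OF dxx[OF y0 t0]] refl | simp)+
  qed (use wx at_t0[OF y0] Z0 in auto)
  have ymin: "w x0 y0 t0 \<le> w x0 y t0" if "y \<in> {0..H}" for y
    using at_t0[OF that, of x0] Z0 by (simp add: Z_def)
  have wy: "wy x0 y0 t0 = 0"
    by (rule derivative_zero_at_min_matching_ends[OF \<open>0 < H\<close> y0 dy[OF _ t0] bc[OF t0] ymin])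
  have wyy: "0 \<le> wyy x0 y0 t0"
    by (rule second_derivative_nonneg_at_min[OF \<open>0 < H\<close> y0 dy[OF _ t0] dyy[OF y0 t0] wy ymin])
  have "\<kappa> * (- (2 * E)) \<le> \<kappa> * (wxx x0 y0 t0 + wyy x0 y0 t0)"
    using wxx wyy \<open>0 < \<kappa>\<close> by (intro mult_left_mono) auto
  moreover have "- (U * (E * (1 + x0\<^sup>2))) \<le> - (u y0 * wx x0 y0 t0)"
  proof -
    have "\<bar>wx x0 y0 t0\<bar> \<le> E * (1 + x0\<^sup>2)"
    proof -
      have "wx x0 y0 t0 = - (E * (2 * x0))" using wx by linarith
      then have "\<bar>wx x0 y0 t0\<bar> = E * (2 * \<bar>x0\<bar>)" using E by (simp add: abs_mult)
      moreover have "2 * \<bar>x0\<bar> \<le> 1 + x0\<^sup>2" using zero_le_power2[of "\<bar>x0\<bar> - 1"] by (simp add: power2_diff)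
      ultimately show ?thesis using E by (simp add: mult_left_mono)
    qed
    then have "\<bar>u y0 * wx x0 y0 t0\<bar> \<le> U * (E * (1 + x0\<^sup>2))"
      unfolding abs_mult using u[OF y0] U0 by (intro mult_mono) auto
    then show ?thesis by linarith
  qed
  ultimately have "- (2 * \<kappa> * E) - U * (E * (1 + x0\<^sup>2)) - L * (E * (1 + x0\<^sup>2)) \<le> - (E * \<Lambda> * (1 + x0\<^sup>2))"
    using super[OF y0 t0 w0neg] wt unfolding w0 by (simp add: algebra_simps)
  then have "E * (1 + x0\<^sup>2) + 2 * \<kappa> * E * x0\<^sup>2 \<le> 0"
    unfolding \<Lambda>_def by (simp add: algebra_simps)
  moreover have "0 < E * (1 + x0\<^sup>2)" using E pos1 by simp
  moreover have "0 \<le> 2 * \<kappa> * E * x0\<^sup>2" using E \<open>0 < \<kappa>\<close> by simp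
  ultimately show False by linarith
qed

section \<open>Integrals over rectangles and the flux identity\<close>

lemma continuous_on_Icc_bounded:
  fixes g :: "real \<Rightarrow> real"
  assumes "continuous_on {a..b} g"
  obtains K where "\<And>s. s \<in> {a..b} \<Longrightarrow> \<bar>g s\<bar> \<le> K"
proof -
  have "compact (g ` {a..b})" by (rule compact_continuous_image[OF assms]) auto
  then have "\<exists>K. \<forall>r\<in>g ` {a..b}. norm r \<le> K"
    unfolding bounded_iff[symmetric] by (rule compact_imp_bounded)
  then show ?thesis using that by (metis image_eqI real_norm_def)
qed

lemma continuous_on_slice_snd:
  assumes "continuous_on (A \<times> B) (\<lambda>z. F (fst z) (snd z))" "x \<in> A"
  shows "continuous_on B (F x)"
proof -
  have "continuous_on B (\<lambda>y. (\<lambda>z. F (fst z) (snd z)) (x, y))"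
    by (rule continuous_on_compose2[OF assms(1)]) (use assms(2) in \<open>auto intro!: continuous_intros\<close>)
  then show ?thesis by simp
qed

lemma continuous_on_inner_integral:
  fixes F :: "real \<Rightarrow> real \<Rightarrow> real"
  assumes "continuous_on (A \<times> {p..q}) (\<lambda>z. F (fst z) (snd z))"
  shows "continuous_on A (\<lambda>x. integral {p..q} (F x))"
  using integral_continuous_on_param[of A p q F] assms by (simp add: case_prod_beta)

lemma box_integral_add:
  fixes F G :: "real \<Rightarrow> real \<Rightarrow> real"
  assumes F: "continuous_on ({a..b} \<times> {p..q}) (\<lambda>z. F (fst z) (snd z))"
    and G: "continuous_on ({a..b} \<times> {p..q}) (\<lambda>z. G (fst z) (snd z))"
  shows "integral {a..b} (\<lambda>x. integral {p..q} (\<lambda>y. F x y + G x y)) =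
         integral {a..b} (\<lambda>x. integral {p..q} (F x)) + integral {a..b} (\<lambda>x. integral {p..q} (G x))"
proof -
  have "integral {a..b} (\<lambda>x. integral {p..q} (\<lambda>y. F x y + G x y)) =
        integral {a..b} (\<lambda>x. integral {p..q} (F x) + integral {p..q} (G x))"
    by (intro integral_cong integral_add integrable_continuous_real
        continuous_on_slice_snd[OF F] continuous_on_slice_snd[OF G])
  also have "\<dots> = integral {a..b} (\<lambda>x. integral {p..q} (F x)) + integral {a..b} (\<lambda>x. integral {p..q} (G x))"
    by (intro integral_add integrable_continuous_real continuous_on_inner_integral F G)
  finally show ?thesis .
qed

lemma box_integral_mono:
  fixes F G :: "real \<Rightarrow> real \<Rightarrow> real"
  assumes F: "continuous_on ({a..b} \<times> {p..q}) (\<lambda>z. F (fst z) (snd z))"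
    and G: "continuous_on ({a..b} \<times> {p..q}) (\<lambda>z. G (fst z) (snd z))"
    and le: "\<And>x y. x \<in> {a..b} \<Longrightarrow> y \<in> {p..q} \<Longrightarrow> F x y \<le> G x y"
  shows "integral {a..b} (\<lambda>x. integral {p..q} (F x)) \<le> integral {a..b} (\<lambda>x. integral {p..q} (G x))"
  by (intro integral_le integrable_continuous_real continuous_on_inner_integral
      continuous_on_slice_snd[OF F] continuous_on_slice_snd[OF G] F G le)

lemma box_integral_subset:
  fixes F :: "real \<Rightarrow> real \<Rightarrow> real"
  assumes F: "continuous_on ({a..b} \<times> {p..q}) (\<lambda>z. F (fst z) (snd z))"
    and nonneg: "\<And>x y. x \<in> {a..b} \<Longrightarrow> y \<in> {p..q} \<Longrightarrow> 0 \<le> F x y"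
    and sub: "a \<le> a'" "b' \<le> b"
  shows "integral {a'..b'} (\<lambda>x. integral {p..q} (F x)) \<le> integral {a..b} (\<lambda>x. integral {p..q} (F x))"
proof (rule integral_subset_le)
  have c: "continuous_on {a..b} (\<lambda>x. integral {p..q} (F x))"
    by (rule continuous_on_inner_integral[OF F])
  then show "(\<lambda>x. integral {p..q} (F x)) integrable_on {a..b}"
    by (rule integrable_continuous_real)
  show "(\<lambda>x. integral {p..q} (F x)) integrable_on {a'..b'}"
    using sub by (intro integrable_continuous_real continuous_on_subset[OF c]) auto
  show "\<forall>x\<in>{a..b}. 0 \<le> integral {p..q} (F x)"
    by (intro ballI integral_nonneg integrable_continuous_real continuous_on_slice_snd[OF F] nonneg)
qed (use sub in auto)

lemma integral_real_derivative:
  fixes F :: "real \<Rightarrow> real"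
  assumes "a \<le> b" "\<And>x. x \<in> {a..b} \<Longrightarrow> (F has_real_derivative F' x) (at x within {a..b})"
  shows "integral {a..b} F' = F b - F a"
  using fundamental_theorem_of_calculus[of a b F F'] assms
  by (auto simp: has_real_derivative_iff_has_vector_derivative intro: integral_unique)

lemma rectangle_divergence:
  fixes Q Q' S S' :: "real \<Rightarrow> real \<Rightarrow> real"
  assumes "a \<le> b" "p \<le> q"
    and Q: "\<And>x y. x \<in> {a..b} \<Longrightarrow> y \<in> {p..q} \<Longrightarrow> ((\<lambda>s. Q s y) has_real_derivative Q' x y) (at x within {a..b})"
    and S: "\<And>x y. x \<in> {a..b} \<Longrightarrow> y \<in> {p..q} \<Longrightarrow> (S x has_real_derivative S' x y) (at y within {p..q})"
    and Q': "continuous_on ({a..b} \<times> {p..q}) (\<lambda>z. Q' (fst z) (snd z))"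
    and S': "continuous_on ({a..b} \<times> {p..q}) (\<lambda>z. S' (fst z) (snd z))"
    and ends: "\<And>x. x \<in> {a..b} \<Longrightarrow> S x p = S x q"
  shows "integral {a..b} (\<lambda>x. integral {p..q} (\<lambda>y. Q' x y + S' x y)) = integral {p..q} (\<lambda>y. Q b y - Q a y)"
proof -
  have "integral {a..b} (\<lambda>x. integral {p..q} (S' x)) = integral {a..b} (\<lambda>x. 0)"
    using integral_real_derivative[OF \<open>p \<le> q\<close> S] ends by (intro integral_cong) auto
  moreover have "integral {a..b} (\<lambda>x. integral {p..q} (Q' x)) = integral {p..q} (\<lambda>y. integral {a..b} (\<lambda>x. Q' x y))"
    using integral_swap_continuous[of a p b q Q'] Q' by (simp add: case_prod_beta cbox_Pair_eq)
  moreover have "\<dots> = integral {p..q} (\<lambda>y. Q b y - Q a y)"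
    using integral_real_derivative[OF \<open>a \<le> b\<close> Q] by (intro integral_cong) auto
  ultimately show ?thesis using box_integral_add[OF Q' S'] by simp
qed

text \<open>A snapshot of the solution at one time. \<open>Pt\<close> is an independent function
  tied to \<open>P\<close> only by \<open>eqn\<close> and its sign, so the flux and energy arguments
  become statements about an equation in \<open>x\<close> and \<open>y\<close> alone.\<close>

locale front_profile =
  fixes H \<kappa> v0 :: real and f f' u :: "real \<Rightarrow> real"
    and P Pt Px Py Pxx Pyy :: "real \<Rightarrow> real \<Rightarrow> real"
  assumes pos: "0 < H" "0 < \<kappa>" "0 < v0"
    and f: "\<And>s. s \<in> {0..1} \<Longrightarrow> (f has_real_derivative f' s) (at s within {0..1})"
    and f': "continuous_on {0..1} f'"
    and f_nonneg: "\<And>s. s \<in> {0..1} \<Longrightarrow> 0 \<le> f s"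
    and u: "continuous_on {0..H} u" "integral {0..H} u = 0"
    and range: "\<And>x y. y \<in> {0..H} \<Longrightarrow> P x y \<in> {0..1}"
    and dx: "\<And>x y. y \<in> {0..H} \<Longrightarrow> ((\<lambda>s. P s y) has_real_derivative Px x y) (at x)"
    and dxx: "\<And>x y. y \<in> {0..H} \<Longrightarrow> ((\<lambda>s. Px s y) has_real_derivative Pxx x y) (at x)"
    and dy: "\<And>x y. y \<in> {0..H} \<Longrightarrow> (P x has_real_derivative Py x y) (at y within {0..H})"
    and dyy: "\<And>x y. y \<in> {0..H} \<Longrightarrow> (Py x has_real_derivative Pyy x y) (at y within {0..H})"
    and cont: "continuous_on (UNIV \<times> {0..H}) (\<lambda>z. P (fst z) (snd z))"
      "continuous_on (UNIV \<times> {0..H}) (\<lambda>z. Pt (fst z) (snd z))"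
      "continuous_on (UNIV \<times> {0..H}) (\<lambda>z. Px (fst z) (snd z))"
      "continuous_on (UNIV \<times> {0..H}) (\<lambda>z. Py (fst z) (snd z))"
      "continuous_on (UNIV \<times> {0..H}) (\<lambda>z. Pxx (fst z) (snd z))"
      "continuous_on (UNIV \<times> {0..H}) (\<lambda>z. Pyy (fst z) (snd z))"
    and eqn: "\<And>x y. y \<in> {0..H} \<Longrightarrow>
        Pt x y + u y * Px x y = \<kappa> * (Pxx x y + Pyy x y) + v0\<^sup>2 / \<kappa> * f (P x y)"
    and Pt_nonneg: "\<And>x y. y \<in> {0..H} \<Longrightarrow> 0 \<le> Pt x y"
    and lim: "\<And>y. y \<in> {0..H} \<Longrightarrow> ((\<lambda>x. P x y) \<longlongrightarrow> 1) at_bot"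
      "\<And>y. y \<in> {0..H} \<Longrightarrow> ((\<lambda>x. P x y) \<longlongrightarrow> 0) at_top"
    and bc: "\<And>x. matching_ends H (P x) (Py x)"
begin

lemma continuous_comp:
  assumes "continuous_on {0..1} g"
  shows "continuous_on (UNIV \<times> {0..H}) (\<lambda>z. g (P (fst z) (snd z)))"
  by (rule continuous_on_compose2[OF assms cont(1)]) (use range in auto)

lemma chain_x:
  assumes "\<And>s. s \<in> {0..1} \<Longrightarrow> (k has_real_derivative k' s) (at s within {0..1})" "y \<in> {0..H}"
  shows "((\<lambda>s. k (P s y)) has_real_derivative k' (P x y) * Px x y) (at x)"
proof -
  have "(k has_real_derivative k' (P x y)) (at (P x y) within (\<lambda>s. P s y) ` UNIV)"
    by (rule DERIV_subset[OF assms(1)]) (use range assms(2) in auto)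
  from DERIV_image_chain[OF this dx[OF assms(2)]] show ?thesis by (simp add: o_def)
qed

text \<open>The limits at infinity hold for each \<open>y\<close> separately, with no uniformity. As
  \<open>P\<close> stays in \<open>{0..1}\<close>, where \<open>g\<close> is bounded, dominated
  convergence still applies.\<close>

lemma slice_limit:
  fixes g :: "real \<Rightarrow> real"
  assumes g: "continuous_on {0..1} g" and \<psi>: "continuous_on {p..q} \<psi>" and pq: "0 \<le> p" "q \<le> H"
    and X: "\<And>y. y \<in> {0..H} \<Longrightarrow> (\<lambda>n. P (X n) y) \<longlonglongrightarrow> r"
  shows "(\<lambda>n. integral {p..q} (\<lambda>y. \<psi> y * g (P (X n) y))) \<longlonglongrightarrow> g r * integral {p..q} \<psi>"
proof (cases "p \<le> q")
  case True
  have r: "r \<in> {0..1}"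
  proof -
    have "p \<in> {0..H}" using pq True by auto
    then show ?thesis using X[of p] range by (intro Lim_in_closed_set[OF _ _ _ X[of p]]) auto
  qed
  obtain M where M: "\<And>s. s \<in> {0..1} \<Longrightarrow> \<bar>g s\<bar> \<le> M"
    using continuous_on_Icc_bounded[OF g] by blast
  have sub: "{p..q} \<subseteq> {0..H}" using pq by auto
  have gc: "continuous_on {p..q} (\<lambda>y. g (P x y))" for x
    by (rule continuous_on_subset[OF continuous_on_slice_snd[OF continuous_comp[OF g]]]) (use sub in auto)
  have "(\<lambda>n. integral {p..q} (\<lambda>y. \<psi> y * g (P (X n) y))) \<longlonglongrightarrow> integral {p..q} (\<lambda>y. \<psi> y * g r)"
  proof (rule dominated_convergence(2))
    show "(\<lambda>y. \<psi> y * g (P (X n) y)) integrable_on {p..q}" for n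
      by (intro integrable_continuous_real continuous_intros \<psi> gc)
    show "(\<lambda>y. \<bar>\<psi> y\<bar> * M) integrable_on {p..q}"
      by (intro integrable_continuous_real continuous_intros \<psi>)
    show "norm (\<psi> y * g (P (X n) y)) \<le> \<bar>\<psi> y\<bar> * M" if "y \<in> {p..q}" for n y
      using that sub M[of "P (X n) y"] range by (auto simp: abs_mult intro!: mult_left_mono)
    show "(\<lambda>n. \<psi> y * g (P (X n) y)) \<longlonglongrightarrow> \<psi> y * g r" if "y \<in> {p..q}" for y
      using that sub r range
      by (intro tendsto_intros continuous_on_tendsto_compose[OF g X]) (auto intro!: always_eventually)
  qed
  then show ?thesis by (simp add: mult.commute)
next
  case False
  then show ?thesis by simp
qed

text \<open>The equation is multiplied by \<open>\<phi> y * g (P x y)\<close> and integrated over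
  rectangles. Because \<open>G\<close> is a primitive of \<open>g\<close>, the advective term is an
  exact \<open>x\<close>-derivative, and its limits at the two far sides form the right-hand side.
  The hypothesis \<open>ends\<close> serves two uses: a constant weight on the full width under the
  boundary conditions, and a weight vanishing at \<open>p\<close> and \<open>q\<close>.\<close>

lemma flux_limit:
  fixes g g' G \<phi> \<phi>' :: "real \<Rightarrow> real"
  assumes G: "\<And>s. s \<in> {0..1} \<Longrightarrow> (G has_real_derivative g s) (at s within {0..1})"
    and g: "\<And>s. s \<in> {0..1} \<Longrightarrow> (g has_real_derivative g' s) (at s within {0..1})"
    and g': "continuous_on {0..1} g'"
    and \<phi>: "\<And>y. y \<in> {p..q} \<Longrightarrow> (\<phi> has_real_derivative \<phi>' y) (at y within {p..q})"
    and \<phi>': "continuous_on {p..q} \<phi>'"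
    and pq: "0 \<le> p" "p < q" "q \<le> H"
    and ends: "\<And>x. \<phi> p * (g (P x p) * Py x p) = \<phi> q * (g (P x q) * Py x q)"
  obtains a b :: "nat \<Rightarrow> real" where
    "\<And>n. a n \<in> {- real n - 1..- real n}" "\<And>n. b n \<in> {real n..real n + 1}"
    "(\<lambda>n. integral {a n..b n} (\<lambda>x. integral {p..q} (\<lambda>y.
        \<phi> y * (g (P x y) * (Pt x y - v0\<^sup>2 / \<kappa> * f (P x y)))
        + \<kappa> * (\<phi> y * (g' (P x y) * ((Px x y)\<^sup>2 + (Py x y)\<^sup>2)))
        + \<kappa> * (\<phi>' y * (g (P x y) * Py x y)))))
      \<longlonglongrightarrow> (G 1 - G 0) * integral {p..q} (\<lambda>y. \<phi> y * u y)"
proof -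
  have sub: "{p..q} \<subseteq> {0..H}" using pq by auto
  have Gc: "continuous_on {0..1} G" and gc: "continuous_on {0..1} g" and \<phi>c: "continuous_on {p..q} \<phi>"
    by (auto intro!: DERIV_continuous_on G g \<phi>)
  have uc: "continuous_on {p..q} u" by (rule continuous_on_subset[OF u(1) sub])
  have sub': "UNIV \<times> {p..q} \<subseteq> UNIV \<times> {0..H}" using sub by auto
  note cs = continuous_on_subset[OF cont(1) sub'] continuous_on_subset[OF cont(2) sub']
    continuous_on_subset[OF cont(3) sub'] continuous_on_subset[OF cont(4) sub']
    continuous_on_subset[OF cont(5) sub'] continuous_on_subset[OF cont(6) sub']
  note gs = continuous_on_subset[OF continuous_comp[OF gc] sub']
    continuous_on_subset[OF continuous_comp[OF g'] sub']
    continuous_on_subset[OF continuous_comp[OF Gc] sub']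
  have snd: "continuous_on (A \<times> {p..q}) (\<lambda>z. \<psi> (snd z))" if "continuous_on {p..q} \<psi>" for \<psi> :: "real \<Rightarrow> real" and A :: "real set"
    by (rule continuous_on_compose2[OF that]) (auto intro!: continuous_intros)
  have chain_y: "((\<lambda>s. k (P x s)) has_real_derivative k' (P x y) * Py x y) (at y within {p..q})"
    if "\<And>s. s \<in> {0..1} \<Longrightarrow> (k has_real_derivative k' s) (at s within {0..1})" "y \<in> {p..q}" for k k' x y
  proof -
    have "(k has_real_derivative k' (P x y)) (at (P x y) within P x ` {p..q})"
      by (rule DERIV_subset[OF that(1)]) (use range that sub in auto)
    from DERIV_image_chain[OF this DERIV_subset[OF dy sub]] show ?thesis using that sub by (auto simp: o_def)
  qed
  txt \<open>
    No decay of \<open>Px\<close> is known. But \<open>m\<close> converges at both ends, so the mean value theorem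
    supplies cross-sections at which the diffusive flux \<open>\<kappa> m'\<close> is arbitrarily small.
  \<close>
  define m where "m x = integral {p..q} (\<lambda>y. \<phi> y * G (P x y))" for x
  define m' where "m' x = integral {p..q} (\<lambda>y. \<phi> y * (g (P x y) * Px x y))" for x
  have m': "(m has_real_derivative m' x) (at x)" for x
    unfolding m_def m'_def
  proof -
    have 1: "((\<lambda>x. \<phi> y * G (P x y)) has_real_derivative \<phi> y * (g (P x y) * Px x y)) (at x)"
      if "p \<le> y \<and> y \<le> q" for x y
      using that sub by (auto intro!: DERIV_cmult chain_x[OF G])
    have 2: "(\<lambda>y. \<phi> y * G (P x y)) integrable_on {p..q}" for x
      by (intro integrable_continuous_real continuous_intros \<phi>c continuous_on_slice_snd[OF gs(3)]) auto
    have 3: "continuous_on (UNIV \<times> {p..q}) (\<lambda>(x, y). \<phi> y * (g (P x y) * Px x y))"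
      unfolding case_prod_beta by (intro continuous_intros snd \<phi>c gs cs)
    show "((\<lambda>x. integral {p..q} (\<lambda>y. \<phi> y * G (P x y))) has_real_derivative
        integral {p..q} (\<lambda>y. \<phi> y * (g (P x y) * Px x y))) (at x)"
      using leibniz_rule_field_derivative[of UNIV p q "\<lambda>x y. \<phi> y * G (P x y)"
          "\<lambda>x y. \<phi> y * (g (P x y) * Px x y)" x] 1 2 3 by simp
  qed
  have mean: "\<forall>r. \<exists>z. z \<in> {r..r + 1} \<and> m (r + 1) - m r = m' z"
  proof
    fix r
    obtain z where "z > r" "z < r + 1" "m (r + 1) - m r = (r + 1 - r) * m' z"
      using MVT2[of r "r+1" m m'] m' by auto
    then show "\<exists>z. z \<in> {r..r + 1} \<and> m (r + 1) - m r = m' z" by (intro exI[of _ z]) auto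
  qed
  obtain z where z: "\<And>r. z r \<in> {r..r + 1}" "\<And>r. m (r + 1) - m r = m' (z r)"
    using choice[OF mean] by blast
  define a where "a n = z (- real n - 1)" for n
  define b where "b n = z (real n)" for n
  have a: "a n \<in> {- real n - 1..- real n}" "m (- real n) - m (- real n - 1) = m' (a n)" for n
    using z(1)[of "- real n - 1"] z(2)[of "- real n - 1"] by (auto simp: a_def)
  have b: "b n \<in> {real n..real n + 1}" "m (real n + 1) - m (real n) = m' (b n)" for n
    using z(1)[of "real n"] z(2)[of "real n"] by (auto simp: b_def)
  have real_top: "filterlim (\<lambda>n. real n) at_top sequentially" by (rule filterlim_real_sequentially)
  have b_top: "filterlim b at_top sequentially"
    by (rule filterlim_at_top_mono[OF real_top]) (use b(1) in auto)
  have a_bot: "filterlim a at_bot sequentially"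
    by (rule filterlim_at_bot_mono[of "\<lambda>n. - real n"])
      (use a(1) real_top in \<open>auto simp: filterlim_uminus_at_top\<close>)
  have at_bot_lim: "(\<lambda>n. P (X n) y) \<longlonglongrightarrow> 1" if "filterlim X at_bot sequentially" "y \<in> {0..H}" for X y
    by (rule filterlim_compose[OF lim(1) that(1)]) fact
  have at_top_lim: "(\<lambda>n. P (X n) y) \<longlonglongrightarrow> 0" if "filterlim X at_top sequentially" "y \<in> {0..H}" for X y
    by (rule filterlim_compose[OF lim(2) that(1)]) fact
  have m_top: "(\<lambda>n. m (X n)) \<longlonglongrightarrow> G 0 * integral {p..q} \<phi>" if "filterlim X at_top sequentially" for X
    unfolding m_def by (rule slice_limit[OF Gc \<phi>c _ _ at_top_lim[OF that]]) (use pq in auto)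
  have m_bot: "(\<lambda>n. m (X n)) \<longlonglongrightarrow> G 1 * integral {p..q} \<phi>" if "filterlim X at_bot sequentially" for X
    unfolding m_def by (rule slice_limit[OF Gc \<phi>c _ _ at_bot_lim[OF that]]) (use pq in auto)
  have m'_b: "(\<lambda>n. m' (b n)) \<longlonglongrightarrow> 0"
  proof -
    have "filterlim (\<lambda>n. real n + 1) at_top sequentially"
      by (rule filterlim_at_top_mono[OF real_top]) auto
    from tendsto_diff[OF m_top[OF this] m_top[OF real_top]] show ?thesis by (simp add: b(2))
  qed
  have m'_a: "(\<lambda>n. m' (a n)) \<longlonglongrightarrow> 0"
  proof -
    have 1: "filterlim (\<lambda>n. - real n) at_bot sequentially"
      using real_top by (simp add: filterlim_uminus_at_top)
    have 2: "filterlim (\<lambda>n. - real n - 1) at_bot sequentially"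
      by (rule filterlim_at_bot_mono[OF 1]) auto
    from tendsto_diff[OF m_bot[OF 1] m_bot[OF 2]] show ?thesis using a(2) by simp
  qed
  \<comment> \<open>\<open>(Q, S)\<close> is the flux field: the weighted diffusive flux \<kappa>
    \<phi> g(P) \<nabla>P, minus the advective flux \<phi> u G(P) in the
    \<open>x\<close>-direction.\<close>
  define Q where "Q x y = \<kappa> * (\<phi> y * (g (P x y) * Px x y)) - \<phi> y * u y * G (P x y)" for x y
  define Q' where "Q' x y = \<kappa> * (\<phi> y * (g' (P x y) * Px x y * Px x y + g (P x y) * Pxx x y))
     - \<phi> y * u y * (g (P x y) * Px x y)" for x y
  define S where "S x y = \<kappa> * (\<phi> y * (g (P x y) * Py x y))" for x y
  define S' where "S' x y = \<kappa> * (\<phi>' y * (g (P x y) * Py x y)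
     + \<phi> y * (g' (P x y) * Py x y * Py x y + g (P x y) * Pyy x y))" for x y
  have box: "integral {a n..b n} (\<lambda>x. integral {p..q} (\<lambda>y. Q' x y + S' x y))
      = integral {p..q} (\<lambda>y. Q (b n) y - Q (a n) y)" for n
  proof (rule rectangle_divergence)
    show "a n \<le> b n" using a(1)[of n] b(1)[of n] by auto
    show "((\<lambda>s. Q s y) has_real_derivative Q' x y) (at x within {a n..b n})" if "y \<in> {p..q}" for x y
      unfolding Q_def Q'_def
      by (rule has_field_derivative_at_within)
        (use that sub in \<open>auto intro!: derivative_eq_intros chain_x[OF g] chain_x[OF G] dxx simp: algebra_simps\<close>)
    show "(S x has_real_derivative S' x y) (at y within {p..q})" if "y \<in> {p..q}" for x y
      unfolding S_def S'_def
      by (use that sub in \<open>auto intro!: derivative_eq_intros chain_y[OF g] \<phi> DERIV_subset[OF dyy sub] simp: algebra_simps\<close>)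
    have s: "{a n..b n} \<times> {p..q} \<subseteq> UNIV \<times> {p..q}" by auto
    show "continuous_on ({a n..b n} \<times> {p..q}) (\<lambda>z. Q' (fst z) (snd z))"
      unfolding Q'_def
      by (rule continuous_on_subset[OF _ s]) (intro continuous_intros snd \<phi>c uc gs cs)
    show "continuous_on ({a n..b n} \<times> {p..q}) (\<lambda>z. S' (fst z) (snd z))"
      unfolding S'_def
      by (rule continuous_on_subset[OF _ s]) (intro continuous_intros snd \<phi>c \<phi>' uc gs cs)
    show "S x p = S x q" for x using ends[of x] by (simp add: S_def)
  qed (use pq in auto)
  have flux: "integral {p..q} (Q x) = \<kappa> * m' x - integral {p..q} (\<lambda>y. \<phi> y * u y * G (P x y))"
    and Qint: "Q x integrable_on {p..q}" for x
  proof -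
    have 1: "(\<lambda>y. \<kappa> * (\<phi> y * (g (P x y) * Px x y))) integrable_on {p..q}"
      by (intro integrable_continuous_real continuous_intros \<phi>c continuous_on_slice_snd[OF gs(1)] continuous_on_slice_snd[OF cs(3)]) auto
    have 2: "(\<lambda>y. \<phi> y * u y * G (P x y)) integrable_on {p..q}"
      by (intro integrable_continuous_real continuous_intros \<phi>c uc continuous_on_slice_snd[OF gs(3)]) auto
    show "integral {p..q} (Q x) = \<kappa> * m' x - integral {p..q} (\<lambda>y. \<phi> y * u y * G (P x y))"
      unfolding Q_def using integral_diff[OF 1 2] by (simp add: m'_def)
    show "Q x integrable_on {p..q}" unfolding Q_def by (rule integrable_diff[OF 1 2])
  qed
  have "(\<lambda>n. integral {p..q} (\<lambda>y. \<phi> y * u y * G (P (b n) y))) \<longlonglongrightarrow> G 0 * integral {p..q} (\<lambda>y. \<phi> y * u y)"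
    by (rule slice_limit[OF Gc _ _ _ at_top_lim[OF b_top]]) (use pq in \<open>auto intro!: continuous_intros \<phi>c uc\<close>)
  moreover have "(\<lambda>n. integral {p..q} (\<lambda>y. \<phi> y * u y * G (P (a n) y))) \<longlonglongrightarrow> G 1 * integral {p..q} (\<lambda>y. \<phi> y * u y)"
    by (rule slice_limit[OF Gc _ _ _ at_bot_lim[OF a_bot]]) (use pq in \<open>auto intro!: continuous_intros \<phi>c uc\<close>)
  ultimately have "(\<lambda>n. integral {p..q} (Q (b n)) - integral {p..q} (Q (a n)))
     \<longlonglongrightarrow> (\<kappa> * 0 - G 0 * integral {p..q} (\<lambda>y. \<phi> y * u y)) - (\<kappa> * 0 - G 1 * integral {p..q} (\<lambda>y. \<phi> y * u y))"
    unfolding flux by (intro tendsto_intros m'_a m'_b)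
  then have L: "(\<lambda>n. integral {a n..b n} (\<lambda>x. integral {p..q} (\<lambda>y. Q' x y + S' x y)))
     \<longlonglongrightarrow> (G 1 - G 0) * integral {p..q} (\<lambda>y. \<phi> y * u y)"
    unfolding box by (simp add: integral_diff[OF Qint Qint] algebra_simps)
  \<comment> \<open>In the divergence of the flux field, \<open>eqn\<close> trades diffusion minus
    advection for \<open>Pt\<close> minus reaction; what remains comes from differentiating
    \<open>g (P x y)\<close> and \<open>\<phi>\<close>.\<close>
  have E: "Q' x y + S' x y = \<phi> y * (g (P x y) * (Pt x y - v0\<^sup>2 / \<kappa> * f (P x y)))
        + \<kappa> * (\<phi> y * (g' (P x y) * ((Px x y)\<^sup>2 + (Py x y)\<^sup>2)))
        + \<kappa> * (\<phi>' y * (g (P x y) * Py x y))" if "y \<in> {p..q}" for x y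
  proof -
    have *: "Pt x y - v0\<^sup>2 / \<kappa> * f (P x y) = \<kappa> * (Pxx x y + Pyy x y) - u y * Px x y"
      using eqn[of y x] that sub by auto
    show ?thesis unfolding Q'_def S'_def * by (simp add: algebra_simps power2_eq_square)
  qed
  have "integral {a n..b n} (\<lambda>x. integral {p..q} (\<lambda>y. Q' x y + S' x y)) =
      integral {a n..b n} (\<lambda>x. integral {p..q} (\<lambda>y.
        \<phi> y * (g (P x y) * (Pt x y - v0\<^sup>2 / \<kappa> * f (P x y)))
        + \<kappa> * (\<phi> y * (g' (P x y) * ((Px x y)\<^sup>2 + (Py x y)\<^sup>2)))
        + \<kappa> * (\<phi>' y * (g (P x y) * Py x y))))" for n
    by (intro integral_cong E)
  with L a(1) b(1) show ?thesis by (intro that[of a b]) auto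
qed

end

section \<open>Intervals and exhaustion of the strip\<close>

text \<open>Only the open intervals are disjoint; their closures may share endpoints. Passing
  between the two does not change the integrals, so the sum is one integral over a subset of
  \<open>{0..H}\<close>.\<close>

lemma sum_integral_disjoint_intervals:
  fixes \<omega> :: "real \<Rightarrow> real"
  assumes "finite F" and disj: "disjoint_family_on (\<lambda>j. {c j - h j<..<c j + h j}) F"
    and sub: "\<And>j. j \<in> F \<Longrightarrow> {c j - h j..c j + h j} \<subseteq> {0..H}"
    and \<omega>: "continuous_on {0..H} \<omega>" "\<And>y. y \<in> {0..H} \<Longrightarrow> 0 \<le> \<omega> y"
  shows "(\<Sum>j\<in>F. integral {c j - h j..c j + h j} \<omega>) \<le> integral {0..H} \<omega>"
proof -
  let ?I = "\<lambda>j. {c j - h j<..<c j + h j}"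
  have int: "(\<omega> has_integral integral {c j - h j..c j + h j} \<omega>) (?I j)" if "j \<in> F" for j
    unfolding has_integral_Icc_iff_Ioo[symmetric]
    by (intro integrable_integral integrable_continuous_real continuous_on_subset[OF \<omega>(1) sub[OF that]])
  have un: "(\<omega> has_integral (\<Sum>j\<in>F. integral {c j - h j..c j + h j} \<omega>)) (\<Union>j\<in>F. ?I j)"
    by (rule has_integral_UN[OF \<open>finite F\<close> int])
      (use disj in \<open>auto simp: pairwise_def disjoint_family_on_def\<close>)
  have "(\<omega> has_integral integral {0..H} \<omega>) {0..H}"
    by (intro integrable_integral integrable_continuous_real \<omega>(1))
  moreover have "(\<Union>j\<in>F. ?I j) \<subseteq> {0..H}" 
  proof (intro UN_least)
    show "?I j \<subseteq> {0..H}" if "j \<in> F" for j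
      by (rule order_trans[OF _ sub[OF that]]) auto
  qed
  ultimately show ?thesis using has_integral_subset_le[OF _ un] \<omega>(2) by blast
qed

text \<open>The weight has integral \<open>4 * h / 3\<close>, so with
  \<open>\<bar>u y\<bar> \<ge> N / 2\<close> the weighted integral of \<bar>u\<bar> is at least
  \<open>2 * h * N / 3\<close>, whereas the unweighted one is at most \<open>2 * h * N\<close>:
  hence the factor 3. For \<open>N > 0\<close> the lower bound also keeps \<open>u\<close> away from
  zero, so it has one sign and nothing cancels when the absolute value moves outside.\<close>

lemma parabola_weight_lower_bound:
  fixes u :: "real \<Rightarrow> real"
  assumes "0 < h" and u: "continuous_on {c - h..c + h} u"
    and N: "\<And>y. y \<in> {c - h<..<c + h} \<Longrightarrow> N / 2 \<le> \<bar>u y\<bar> \<and> \<bar>u y\<bar> \<le> N"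
  shows "integral {c - h..c + h} (\<lambda>y. \<bar>u y\<bar>) \<le> 3 * \<bar>integral {c - h..c + h} (\<lambda>y. (1 - ((y - c) / h)\<^sup>2) * u y)\<bar>"
proof -
  let ?I = "{c - h..c + h}"
  have cl: "closure {c - h<..<c + h} = ?I" using \<open>0 < h\<close> by simp
  have abs_u: "continuous_on (closure {c - h<..<c + h}) (\<lambda>y. \<bar>u y\<bar>)"
    unfolding cl by (intro continuous_intros u)
  \<comment> \<open>The bounds are given on the open interval and extend to its closure by
    continuity.\<close>
  have N': "N / 2 \<le> \<bar>u y\<bar>" "\<bar>u y\<bar> \<le> N" if "y \<in> ?I" for y
    using continuous_ge_on_closure[OF abs_u, of y "N/2"] continuous_le_on_closure[OF abs_u, of y N] N that
    unfolding cl by auto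
  let ?\<phi> = "\<lambda>y. 1 - ((y - c) / h)\<^sup>2"
  have \<phi>0: "0 \<le> ?\<phi> y" if "y \<in> ?I" for y
  proof -
    have "\<bar>(y - c) / h\<bar> \<le> 1" using that \<open>0 < h\<close> by (auto simp: abs_le_iff field_simps)
    then show ?thesis by (simp add: abs_square_le_1)
  qed
  have \<phi>c: "continuous_on ?I ?\<phi>" by (intro continuous_intros) (use \<open>0 < h\<close> in auto)
  have \<phi>i: "integral ?I ?\<phi> = 4 * h / 3"
  proof -
    have "integral ?I ?\<phi> = (c + h - (c + h - c) ^ 3 / (3 * h\<^sup>2)) - (c - h - (c - h - c) ^ 3 / (3 * h\<^sup>2))"
      by (rule integral_real_derivative)
        (use \<open>0 < h\<close> in \<open>auto intro!: derivative_eq_intros simp: power_divide power2_eq_square power4_eq_xxxx\<close>)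
    also have "\<dots> = 4 * h / 3" using \<open>0 < h\<close> by (simp add: field_simps power2_eq_square power3_eq_cube)
    finally show ?thesis .
  qed
  have bound: "integral ?I (\<lambda>y. \<bar>u y\<bar>) \<le> 3 * integral ?I (\<lambda>y. ?\<phi> y * \<bar>u y\<bar>)"
  proof -
    have "integral ?I (\<lambda>y. \<bar>u y\<bar>) \<le> integral ?I (\<lambda>y. N)"
      by (intro integral_le integrable_continuous_real continuous_intros u N'(2))
    also have "\<dots> = 3 * (N / 2 * integral ?I ?\<phi>)" using \<open>0 < h\<close> by (simp add: \<phi>i)
    also have "N / 2 * integral ?I ?\<phi> = integral ?I (\<lambda>y. ?\<phi> y * (N / 2))" by simp
    also have "\<dots> \<le> integral ?I (\<lambda>y. ?\<phi> y * \<bar>u y\<bar>)"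
      by (intro integral_le integrable_continuous_real continuous_intros u \<phi>c mult_left_mono \<phi>0 N'(1))
        (use \<open>0 < h\<close> in auto)
    finally show ?thesis by simp
  qed
  show ?thesis
  proof (cases "0 < N")
    case False
    then have "\<bar>u y\<bar> = 0" if "y \<in> ?I" for y using N'[OF that] by linarith
    then have "integral ?I (\<lambda>y. \<bar>u y\<bar>) = integral ?I (\<lambda>y. 0)" by (intro integral_cong) 
    then show ?thesis by simp
  next
    case True
    have nz: "u y \<noteq> 0" if "y \<in> ?I" for y using N'(1)[OF that] True by auto
    \<comment> \<open>A connected image that avoids 0 lies on one side of it.\<close>
    have "connected (u ` ?I)" by (intro connected_continuous_image u) auto
    moreover have "0 \<notin> u ` ?I" using nz by force
    ultimately have no_change: "\<not> (u y \<le> 0 \<and> 0 \<le> u z)" if "y \<in> ?I" "z \<in> ?I" for y z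
      using connectedD_interval[of "u ` ?I" "u y" "u z" 0] that by blast
    have "(\<forall>y\<in>?I. 0 < u y) \<or> (\<forall>y\<in>?I. u y < 0)"
      using no_change by (meson linorder_not_less)
    then show ?thesis
    proof
      assume p: "\<forall>y\<in>?I. 0 < u y"
      then have "integral ?I (\<lambda>y. ?\<phi> y * \<bar>u y\<bar>) = integral ?I (\<lambda>y. ?\<phi> y * u y)"
        by (intro integral_cong) (metis abs_of_pos)
      then show ?thesis using bound by linarith
    next
      assume p: "\<forall>y\<in>?I. u y < 0"
      then have "integral ?I (\<lambda>y. ?\<phi> y * \<bar>u y\<bar>) = integral ?I (\<lambda>y. - (?\<phi> y * u y))"
        by (intro integral_cong) (metis abs_of_neg mult_minus_right)
      then show ?thesis using bound by simp
    qed
  qed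
qed

text \<open>Passage from iterated integrals over boxes to the Lebesgue integral in the burning rate.
  The latter defaults to 0 for a non-integrable function; the uniform bound \<open>bdd\<close> lets
  monotone convergence establish integrability, and \<open>K\<close> then disappears.\<close>

lemma strip_integral_exhaustion:
  fixes F :: "real \<Rightarrow> real \<Rightarrow> real"
  assumes F: "continuous_on (UNIV \<times> {0..H}) (\<lambda>z. F (fst z) (snd z))"
    and nonneg: "\<And>x y. y \<in> {0..H} \<Longrightarrow> 0 \<le> F x y"
    and bdd: "\<And>n. integral {- real n..real n} (\<lambda>x. integral {0..H} (F x)) \<le> K"
  shows "integral {- real n..real n} (\<lambda>x. integral {0..H} (F x))
           \<le> set_lebesgue_integral lborel (UNIV \<times> {0..H}) (\<lambda>(x, y). F x y)"
proof -
  let ?B = "\<lambda>n::nat. {- real n..real n} \<times> {0..H}"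
  let ?F = "\<lambda>z. F (fst z) (snd z)"
  define I where "I n = integral {- real n..real n} (\<lambda>x. integral {0..H} (F x))" for n :: nat
  have Fn: "continuous_on (?B n) ?F" for n by (rule continuous_on_subset[OF F]) auto
  have int: "integrable lborel (\<lambda>z. indicator (?B n) z *\<^sub>R ?F z)" for n
    by (rule borel_integrable_compact[OF _ Fn]) (intro compact_Times compact_Icc)
  have val: "integral\<^sup>L lborel (\<lambda>z. indicator (?B n) z *\<^sub>R ?F z) = I n" for n
  proof -
    have "set_lebesgue_integral lborel (?B n) ?F = integral (?B n) ?F"
      by (rule set_borel_integral_eq_integral(2)) (use int in \<open>simp add: set_integrable_def\<close>)
    also have "\<dots> = I n"
      using integral_prod_continuous[of "- real n" 0 "real n" H ?F] Fn[of n]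
      by (simp add: cbox_Pair_eq I_def)
    finally show ?thesis by (simp add: set_lebesgue_integral_def)
  qed
  have mono_I: "incseq I"
    unfolding I_def
    by (intro monoI box_integral_subset continuous_on_subset[OF F]) (use nonneg in auto)
  obtain L where L: "I \<longlonglongrightarrow> L" "\<And>n. I n \<le> L"
    using incseq_convergent[OF mono_I, of K] bdd by (auto simp: I_def)
  have "integral\<^sup>L lborel (\<lambda>z. indicator (UNIV \<times> {0..H}) z *\<^sub>R ?F z) = L"
  proof (rule integral_monotone_convergence_nonneg(2)[OF int])
    have step: "indicator (?B n) z *\<^sub>R ?F z \<le> indicator (?B m) z *\<^sub>R ?F z" if "n \<le> m" for n m z
      using that nonneg by (auto simp: indicator_def mem_Times_iff)
    then show "AE z in lborel. mono (\<lambda>n. indicator (?B n) z *\<^sub>R ?F z)"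
      by (auto intro!: AE_I2 monoI)
    show "AE z in lborel. 0 \<le> indicator (?B n) z *\<^sub>R ?F z" for n
      using nonneg by (auto intro!: AE_I2 simp: indicator_def mem_Times_iff)
    have lim: "(\<lambda>n. indicator (?B n) z *\<^sub>R ?F z) \<longlonglongrightarrow> indicator (UNIV \<times> {0..H}) z *\<^sub>R ?F z" for z
    proof (rule tendsto_eventually)
      obtain N :: nat where "\<bar>fst z\<bar> \<le> real N" using real_arch_simple by blast
      then have "indicator (?B n) z = (indicator (UNIV \<times> {0..H}) z :: real)" if "n \<ge> N" for n
        using that by (auto simp: indicator_def mem_Times_iff)
      then show "\<forall>\<^sub>F n in sequentially. indicator (?B n) z *\<^sub>R ?F z = indicator (UNIV \<times> {0..H}) z *\<^sub>R ?F z"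
        by (auto simp: eventually_sequentially)
    qed
    then show "AE z in lborel. (\<lambda>n. indicator (?B n) z *\<^sub>R ?F z) \<longlonglongrightarrow> indicator (UNIV \<times> {0..H}) z *\<^sub>R ?F z"
      by simp
    show "(\<lambda>n. integral\<^sup>L lborel (\<lambda>z. indicator (?B n) z *\<^sub>R ?F z)) \<longlonglongrightarrow> L"
      unfolding val by (rule L(1))
    show "(\<lambda>z. indicator (UNIV \<times> {0..H}) z *\<^sub>R ?F z) \<in> borel_measurable lborel"
      by (rule borel_measurable_LIMSEQ_real[OF lim]) (use int in auto)
  qed
  then show ?thesis using L(2)[of n] by (simp add: set_lebesgue_integral_def case_prod_beta I_def)
qed

lemma integral_exp_abs_le:
  fixes lam r :: real
  assumes "0 < lam"
  shows "integral {- r..r} (\<lambda>x. exp (- lam * \<bar>x\<bar>)) \<le> 2 / lam"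
proof (cases "0 \<le> r")
  case True
  have "integral {0..r} (\<lambda>x. exp (- lam * \<bar>x\<bar>)) = integral {0..r} (\<lambda>x. exp (- lam * x))"
    by (intro integral_cong) auto
  also have "\<dots> = - exp (- lam * r) / lam - (- exp (- lam * 0) / lam)"
    by (rule integral_real_derivative[OF True]) (use assms in \<open>auto intro!: derivative_eq_intros\<close>)
  also have "\<dots> \<le> 1 / lam" using assms by (simp add: field_simps)
  finally have R: "integral {0..r} (\<lambda>x. exp (- lam * \<bar>x\<bar>)) \<le> 1 / lam" .
  have "integral {- r..0} (\<lambda>x. exp (- lam * \<bar>x\<bar>)) = integral {- r..0} (\<lambda>x. exp (lam * x))"
    by (intro integral_cong) auto
  also have "\<dots> = exp (lam * 0) / lam - exp (lam * (- r)) / lam"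
    by (rule integral_real_derivative) (use assms True in \<open>auto intro!: derivative_eq_intros\<close>)
  also have "\<dots> \<le> 1 / lam" using assms by (simp add: field_simps)
  finally have "integral {- r..0} (\<lambda>x. exp (- lam * \<bar>x\<bar>)) \<le> 1 / lam" .
  moreover have "integral {- r..0} (\<lambda>x. exp (- lam * \<bar>x\<bar>)) + integral {0..r} (\<lambda>x. exp (- lam * \<bar>x\<bar>))
     = integral {- r..r} (\<lambda>x. exp (- lam * \<bar>x\<bar>))"
    by (intro Henstock_Kurzweil_Integration.integral_combine integrable_continuous_real continuous_intros) (use True in auto)
  ultimately show ?thesis using R by simp
next
  case False
  then show ?thesis using assms by simp
qed

section \<open>Energy balance at a fixed time\<close>

context front_profile
begin

abbreviation box :: "real \<Rightarrow> real \<Rightarrow> (real \<Rightarrow> real \<Rightarrow> real) \<Rightarrow> real" where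
  "box a b F \<equiv> integral {a..b} (\<lambda>x. integral {0..H} (F x))"

abbreviation strip_continuous :: "(real \<Rightarrow> real \<Rightarrow> real) \<Rightarrow> bool" where
  "strip_continuous F \<equiv> continuous_on (UNIV \<times> {0..H}) (\<lambda>z. F (fst z) (snd z))"

definition react :: "real \<Rightarrow> real \<Rightarrow> real" where
  "react x y = v0\<^sup>2 / \<kappa> * f (P x y)"

definition diss :: "real \<Rightarrow> real \<Rightarrow> real" where
  "diss x y = \<kappa> * ((Px x y)\<^sup>2 + (Py x y)\<^sup>2)"

lemma f_cont: "continuous_on {0..1} f"
  by (auto intro!: DERIV_continuous_on f)

lemma react_cont: "strip_continuous react"
  unfolding react_def by (intro continuous_intros continuous_comp f_cont)

lemma diss_cont: "strip_continuous diss"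
  unfolding diss_def by (intro continuous_intros cont)

lemma react_nonneg: "y \<in> {0..H} \<Longrightarrow> 0 \<le> react x y"
  unfolding react_def using f_nonneg range pos by (auto intro!: mult_nonneg_nonneg)

lemma diss_nonneg: "0 \<le> diss x y"
  unfolding diss_def using pos by simp

lemma box_mono_set:
  assumes "strip_continuous F" "\<And>x y. y \<in> {0..H} \<Longrightarrow> 0 \<le> F x y" "a \<le> a'" "b' \<le> b"
  shows "box a' b' F \<le> box a b F"
  by (rule box_integral_subset[OF continuous_on_subset[OF assms(1)]]) (use assms in auto)

text \<open>Balances hold only on the special boxes of \<open>flux_limit\<close> and up to a
  vanishing error. Nonnegativity of \<open>F\<close> puts any fixed box inside those with large
  \<open>n\<close>, and the error vanishes in the limit.\<close>

lemma box_bounded_by_balance: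
  assumes F: "strip_continuous F" "\<And>x y. y \<in> {0..H} \<Longrightarrow> 0 \<le> F x y"
    and G: "\<And>a b. box a b G \<le> K"
    and ab: "\<And>n. a n \<in> {- real n - 1..- real n}" "\<And>n. b n \<in> {real n..real n + 1}"
    and balance: "\<And>n. box (a n) (b n) F \<le> box (a n) (b n) G + D n"
    and D: "D \<longlonglongrightarrow> 0"
  shows "box r s F \<le> K"
proof -
  have "(\<lambda>n. K + D n) \<longlonglongrightarrow> K + 0" by (intro tendsto_intros D)
  then have lim: "(\<lambda>n. K + D n) \<longlonglongrightarrow> K" by simp
  obtain N :: nat where N: "max \<bar>r\<bar> \<bar>s\<bar> \<le> real N" using real_arch_simple by blast
  have "box r s F \<le> K + D n" if "N \<le> n" for n
  proof -
    have "a n \<le> r" "s \<le> b n" using ab(1)[of n] ab(2)[of n] N that by auto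
    then have "box r s F \<le> box (a n) (b n) F" using F by (intro box_mono_set) auto
    then show ?thesis using balance[of n] G[of "a n" "b n"] by linarith
  qed
  then show ?thesis by (intro LIMSEQ_le_const[OF lim]) auto
qed

lemma ends_flux: "g (P x 0) * Py x 0 = g (P x H) * Py x H"
  using bc[of x] by (auto simp: matching_ends_def)

text \<open>The case \<open>g = 1\<close>, \<phi> = 1 of the flux identity: the limit is the
  integral of \<open>u\<close>, which is 0.\<close>

lemma react_balance:
  obtains a b D where "\<And>n. a n \<in> {- real n - 1..- real n}" "\<And>n. b n \<in> {real n..real n + 1}"
    "\<And>n. box (a n) (b n) Pt = box (a n) (b n) react + D n" "D \<longlonglongrightarrow> 0"
proof -
  obtain a b where ab: "\<And>n. a n \<in> {- real n - 1..- real n}" "\<And>n. b n \<in> {real n..real n + 1}"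
    and L: "(\<lambda>n. integral {a n..b n} (\<lambda>x. integral {0..H} (\<lambda>y.
        1 * (1 * (Pt x y - v0\<^sup>2 / \<kappa> * f (P x y)))
        + \<kappa> * (1 * (0 * ((Px x y)\<^sup>2 + (Py x y)\<^sup>2)))
        + \<kappa> * (0 * (1 * Py x y)))))
      \<longlonglongrightarrow> (1 - 0) * integral {0..H} (\<lambda>y. 1 * u y)"
    by (rule flux_limit[of "\<lambda>s. s" "\<lambda>_. 1" "\<lambda>_. 0" 0 H "\<lambda>_. 1" "\<lambda>_. 0"])
      (use pos ends_flux[of "\<lambda>_. 1"] in auto)
  define D where "D n = box (a n) (b n) (\<lambda>x y. Pt x y - react x y)" for n
  have "D \<longlonglongrightarrow> 0" using L u(2) by (simp add: D_def[abs_def] react_def)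
  moreover have "box (a n) (b n) Pt = box (a n) (b n) react + D n" for n
  proof -
    have s: "{a n..b n} \<times> {0..H} \<subseteq> UNIV \<times> {0..H}" by auto
    have "strip_continuous (\<lambda>x y. Pt x y - react x y)"
      by (intro continuous_intros cont react_cont)
    from box_integral_add[OF continuous_on_subset[OF react_cont s] continuous_on_subset[OF this s]]
    show ?thesis by (simp add: D_def)
  qed
  ultimately show ?thesis using ab that by blast
qed

text \<open>The flux identity with test function \<open>P\<close> itself; \<open>g' = 1\<close>
  turns the gradient term into the dissipation. Only an inequality results, since
  \<open>P * Pt \<ge> 0\<close> is dropped and \<open>P * react\<close> is bounded by
  \<open>react\<close>.\<close>

lemma dissipation_balance:
  obtains a b D where "\<And>n. a n \<in> {- real n - 1..- real n}" "\<And>n. b n \<in> {real n..real n + 1}"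
    "\<And>n. box (a n) (b n) diss \<le> box (a n) (b n) react + D n" "D \<longlonglongrightarrow> 0"
proof -
  obtain a b where ab: "\<And>n. a n \<in> {- real n - 1..- real n}" "\<And>n. b n \<in> {real n..real n + 1}"
    and L: "(\<lambda>n. integral {a n..b n} (\<lambda>x. integral {0..H} (\<lambda>y.
        1 * (P x y * (Pt x y - v0\<^sup>2 / \<kappa> * f (P x y)))
        + \<kappa> * (1 * (1 * ((Px x y)\<^sup>2 + (Py x y)\<^sup>2)))
        + \<kappa> * (0 * (P x y * Py x y)))))
      \<longlonglongrightarrow> (1\<^sup>2 / 2 - 0\<^sup>2 / 2) * integral {0..H} (\<lambda>y. 1 * u y)"
    by (rule flux_limit[of "\<lambda>s. s\<^sup>2 / 2" "\<lambda>s. s" "\<lambda>_. 1" 0 H "\<lambda>_. 1" "\<lambda>_. 0"])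
      (use pos ends_flux[of "\<lambda>s. s"] in \<open>auto intro!: derivative_eq_intros\<close>)
  let ?E = "\<lambda>x y. P x y * (Pt x y - react x y) + diss x y"
  define D where "D n = box (a n) (b n) ?E" for n
  have "D \<longlonglongrightarrow> 0" using L u(2) by (simp add: D_def[abs_def] react_def diss_def)
  moreover have "box (a n) (b n) diss \<le> box (a n) (b n) react + D n" for n
  proof -
    have s: "{a n..b n} \<times> {0..H} \<subseteq> UNIV \<times> {0..H}" by auto
    have E: "strip_continuous ?E" by (intro continuous_intros cont react_cont diss_cont)
    have "box (a n) (b n) diss \<le> box (a n) (b n) (\<lambda>x y. react x y + ?E x y)"
    proof (rule box_integral_mono)
      show "diss x y \<le> react x y + ?E x y" if "y \<in> {0..H}" for x y
      proof -
        have "P x y * react x y \<le> 1 * react x y"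
          using range[OF that] react_nonneg[OF that] by (intro mult_right_mono) auto
        moreover have "0 \<le> P x y * Pt x y" using range[OF that] Pt_nonneg[OF that] by auto
        ultimately show ?thesis by (simp add: algebra_simps)
      qed
    qed (rule continuous_on_subset[OF _ s], intro continuous_intros cont react_cont diss_cont)+
    also have "\<dots> = box (a n) (b n) react + D n"
      unfolding D_def
      by (rule box_integral_add[OF continuous_on_subset[OF react_cont s] continuous_on_subset[OF E s]])
    finally show ?thesis .
  qed
  ultimately show ?thesis using ab that by blast
qed

end

text \<open>
  The exponential tail makes the total reaction finite. Without it, integrability of \<open>Pt\<close>
  would be open, and the Lebesgue integral \<open>rate\<close> below could be the junk value \<open>0\<close>.
\<close>

locale tailed_front_profile = front_profile +
  fixes A lam :: real
  assumes lam: "0 < lam"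
    and tail: "\<And>x y. y \<in> {0..H} \<Longrightarrow> f (P x y) \<le> A * exp (- lam * \<bar>x\<bar>)"
begin

definition rate :: real where
  "rate = set_lebesgue_integral lborel (UNIV \<times> {0..H}) (\<lambda>(x, y). Pt x y)"

text \<open>Only the existence of a bound matters: it depends on the tail constants and must not
  reach the final estimate.\<close>

lemma box_react_bounded: "\<exists>K. \<forall>a b. box a b react \<le> K"
proof -
  have f0: "0 \<le> f (P 0 0)" using f_nonneg range pos by auto
  then have "0 \<le> A" using tail[of 0 0] pos by auto
  define c where "c = v0\<^sup>2 / \<kappa> * A"
  have c: "0 \<le> c" using \<open>0 \<le> A\<close> pos by (simp add: c_def)
  have "box a b react \<le> c * H * (2 / lam)" for a b
  proof -
    define r where "r = max \<bar>a\<bar> \<bar>b\<bar>"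
    have "box a b react \<le> box (- r) r react"
      by (rule box_mono_set[OF react_cont react_nonneg]) (auto simp: r_def)
    also have "\<dots> \<le> box (- r) r (\<lambda>x y. c * exp (- lam * \<bar>x\<bar>))"
    proof (rule box_integral_mono)
      show "react x y \<le> c * exp (- lam * \<bar>x\<bar>)" if "y \<in> {0..H}" for x y
        using mult_left_mono[OF tail[OF that], of "v0\<^sup>2 / \<kappa>" x] pos
        unfolding react_def c_def by (simp add: mult.assoc)
    qed (auto intro!: continuous_intros continuous_on_subset[OF react_cont])
    also have "\<dots> = c * H * integral {- r..r} (\<lambda>x. exp (- lam * \<bar>x\<bar>))"
      using pos by (simp add: mult.commute)
    also have "\<dots> \<le> c * H * (2 / lam)"
      using c pos integral_exp_abs_le[OF lam] by (intro mult_left_mono) auto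
    finally show ?thesis .
  qed
  then show ?thesis by blast
qed

text \<open>The qualitative bound on the reaction first makes \<open>Pt\<close> integrable, so that
  \<open>rate\<close> is a genuine integral; after that, \<open>rate\<close> itself is the
  bound.\<close>

lemma box_Pt_le_rate: "box a b Pt \<le> rate"
proof -
  obtain K where K: "\<And>a b. box a b react \<le> K" using box_react_bounded by blast
  obtain a' b' D where D: "\<And>n. a' n \<in> {- real n - 1..- real n}" "\<And>n. b' n \<in> {real n..real n + 1}"
    "\<And>n. box (a' n) (b' n) Pt = box (a' n) (b' n) react + D n" "D \<longlonglongrightarrow> 0"
    using react_balance by blast
  have bounded: "box r s Pt \<le> K" for r s
    by (rule box_bounded_by_balance[OF cont(2) Pt_nonneg K D(1,2) _ D(4)]) (simp_all add: D(3))
  obtain N :: nat where N: "max \<bar>a\<bar> \<bar>b\<bar> \<le> real N" using real_arch_simple by blast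
  have "box a b Pt \<le> box (- real N) (real N) Pt"
    by (rule box_mono_set[OF cont(2) Pt_nonneg]) (use N in auto)
  also have "\<dots> \<le> rate"
    unfolding rate_def by (rule strip_integral_exhaustion[OF cont(2) Pt_nonneg bounded])
  finally show ?thesis .
qed

text \<open>The same balance read in the opposite direction, which replaces the qualitative bound on
  the reaction by \<open>rate\<close>.\<close>

lemma box_react_le_rate: "box a b react \<le> rate"
proof -
  obtain a' b' D where D: "\<And>n. a' n \<in> {- real n - 1..- real n}" "\<And>n. b' n \<in> {real n..real n + 1}"
    "\<And>n. box (a' n) (b' n) Pt = box (a' n) (b' n) react + D n" "D \<longlonglongrightarrow> 0"
    using react_balance by blast
  have "(\<lambda>n. - D n) \<longlonglongrightarrow> 0" using tendsto_minus[OF D(4)] by simp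
  from box_bounded_by_balance[OF react_cont react_nonneg box_Pt_le_rate D(1,2) _ this] show ?thesis
    by (simp add: D(3))
qed

lemma box_diss_le_rate: "box a b diss \<le> rate"
proof -
  obtain a' b' D where D: "\<And>n. a' n \<in> {- real n - 1..- real n}" "\<And>n. b' n \<in> {real n..real n + 1}"
    "\<And>n. box (a' n) (b' n) diss \<le> box (a' n) (b' n) react + D n" "D \<longlonglongrightarrow> 0"
    using dissipation_balance by blast
  show ?thesis
    by (rule box_bounded_by_balance[OF diss_cont diss_nonneg box_react_le_rate D])
qed

section \<open>Lower bounds for the burning rate: the laminar and the advective contribution\<close>

definition energy :: "real \<Rightarrow> real \<Rightarrow> real" where
  "energy x y = Pt x y + react x y + diss x y"

lemma energy_cont: "strip_continuous energy"
  unfolding energy_def by (intro continuous_intros cont react_cont diss_cont)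

lemma energy_nonneg: "y \<in> {0..H} \<Longrightarrow> 0 \<le> energy x y"
  unfolding energy_def by (intro add_nonneg_nonneg Pt_nonneg react_nonneg diss_nonneg)

lemma box_energy_le_rate: "box a b energy \<le> 3 * rate"
proof -
  have s: "{a..b} \<times> {0..H} \<subseteq> UNIV \<times> {0..H}" by auto
  note c = continuous_on_subset[OF cont(2) s] continuous_on_subset[OF react_cont s]
    continuous_on_subset[OF diss_cont s]
  have "box a b energy = box a b Pt + box a b react + box a b diss"
    unfolding energy_def
    using box_integral_add[of a b 0 H "\<lambda>x y. Pt x y + react x y" diss]
      box_integral_add[of a b 0 H Pt react] c by (simp add: continuous_on_add)
  then show ?thesis
    using box_Pt_le_rate[of a b] box_react_le_rate[of a b] box_diss_le_rate[of a b] by linarith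
qed

text \<open>Expansion of the square of \<open>\<kappa> * \<bar>d\<bar> - v0 * f (P x y)\<close>
  divided by \<kappa>; one factor f of f squared is bounded by \<open>M\<close>, the other stays in
  \<open>react\<close>. The number \<open>d\<close> is kept free because the bound serves
  \<open>Px\<close> in the laminar estimate and \<open>Py\<close> in the cross term.\<close>

lemma mixed_le_energy:
  assumes "f (P x y) \<le> M" "1 \<le> M" "y \<in> {0..H}" and d: "d\<^sup>2 \<le> (Px x y)\<^sup>2 + (Py x y)\<^sup>2"
  shows "2 * v0 * f (P x y) * \<bar>d\<bar> \<le> M * (react x y + diss x y)"
proof -
  have fp: "0 \<le> f (P x y)" using f_nonneg range assms by auto
  have "0 \<le> (\<kappa> * \<bar>d\<bar> - v0 * f (P x y))\<^sup>2 / \<kappa>" using pos by simp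
  also have "\<dots> = \<kappa> * d\<^sup>2 + v0\<^sup>2 / \<kappa> * f (P x y) * f (P x y) - 2 * v0 * f (P x y) * \<bar>d\<bar>"
    using pos by (simp add: power2_eq_square field_simps)
  finally have "2 * v0 * f (P x y) * \<bar>d\<bar> \<le> \<kappa> * d\<^sup>2 + react x y * f (P x y)"
    by (simp add: react_def)
  also have "\<dots> \<le> diss x y + react x y * M"
    unfolding diss_def using d pos assms react_nonneg
    by (intro add_mono mult_left_mono) auto
  also have "\<dots> \<le> M * diss x y + react x y * M"
    using mult_right_mono[OF \<open>1 \<le> M\<close> diss_nonneg[of x y]] by simp
  finally show ?thesis by (simp add: algebra_simps)
qed

text \<open>Along each horizontal line \<open>f (P x y) * Px x y\<close> is the derivative of
  \<open>G (P x y)\<close>, so its total is \<open>G 0 - G 1\<close> whatever the flow. AM-GM bounds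
  \<open>2 * v0\<close> times its modulus by \<open>M\<close> times reaction plus dissipation, each
  of total at most \<open>rate\<close>; the two factors 2 cancel.\<close>

lemma laminar_bound:
  assumes M: "1 \<le> M" "\<And>s. s \<in> {0..1} \<Longrightarrow> f s \<le> M"
    and G: "\<And>s. s \<in> {0..1} \<Longrightarrow> (G has_real_derivative f s) (at s within {0..1})"
  shows "v0 * (G 1 - G 0) * H \<le> M * rate"
proof -
  have Gc: "continuous_on {0..1} G" by (auto intro!: DERIV_continuous_on G)
  have fc: "strip_continuous (\<lambda>x y. f (P x y) * Px x y)"
    by (intro continuous_intros cont continuous_comp f_cont)
  have eq: "box (- real n) (real n) (\<lambda>x y. f (P x y) * Px x y) =
      integral {0..H} (\<lambda>y. 1 * G (P (real n) y)) - integral {0..H} (\<lambda>y. 1 * G (P (- real n) y))" for n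
  proof -
    have "box (- real n) (real n) (\<lambda>x y. f (P x y) * Px x y + 0) =
      integral {0..H} (\<lambda>y. G (P (real n) y) - G (P (- real n) y))"
    \<comment> \<open>With zero vertical flux the divergence identity is just the fundamental
      theorem in \<open>x\<close>, integrated over \<open>y\<close>.\<close>
    proof (rule rectangle_divergence[where S="\<lambda>x y. 0"])
      show "((\<lambda>s. G (P s y)) has_real_derivative f (P x y) * Px x y) (at x within {- real n..real n})"
        if "y \<in> {0..H}" for x y
        by (rule has_field_derivative_at_within[OF chain_x[OF G that]])
      show "continuous_on ({- real n..real n} \<times> {0..H}) (\<lambda>z. f (P (fst z) (snd z)) * Px (fst z) (snd z))"
        by (rule continuous_on_subset[OF fc]) auto
    qed (use pos in auto)
    also have "\<dots> = integral {0..H} (\<lambda>y. G (P (real n) y)) - integral {0..H} (\<lambda>y. G (P (- real n) y))"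
      by (intro integral_diff integrable_continuous_real continuous_on_slice_snd[OF continuous_comp[OF Gc]]) auto
    finally show ?thesis by simp
  qed
  have top: "(\<lambda>n. P (real n) y) \<longlonglongrightarrow> 0" and bot: "(\<lambda>n. P (- real n) y) \<longlonglongrightarrow> 1" if "y \<in> {0..H}" for y
    using filterlim_compose[OF lim(2)[OF that] filterlim_real_sequentially]
      filterlim_compose[OF lim(1)[OF that], of "\<lambda>n. - real n" sequentially] filterlim_real_sequentially
    by (auto simp: filterlim_uminus_at_top)
  have "(\<lambda>n. integral {0..H} (\<lambda>y. 1 * G (P (real n) y)) - integral {0..H} (\<lambda>y. 1 * G (P (- real n) y)))
      \<longlonglongrightarrow> G 0 * integral {0..H} (\<lambda>y. 1) - G 1 * integral {0..H} (\<lambda>y. 1)"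
    by (intro tendsto_diff slice_limit[OF Gc] top bot) (auto intro!: continuous_intros)
  then have L: "(\<lambda>n. - 2 * v0 * box (- real n) (real n) (\<lambda>x y. f (P x y) * Px x y))
      \<longlonglongrightarrow> - 2 * v0 * (G 0 * integral {0..H} (\<lambda>y. 1) - G 1 * integral {0..H} (\<lambda>y. 1))"
    unfolding eq by (rule tendsto_mult_left)
  have le: "- 2 * v0 * box (- real n) (real n) (\<lambda>x y. f (P x y) * Px x y) \<le> M * (2 * rate)" for n
  proof -
    let ?a = "- real n" and ?b = "real n"
    have s: "{?a..?b} \<times> {0..H} \<subseteq> UNIV \<times> {0..H}" by auto
    have "- 2 * v0 * box ?a ?b (\<lambda>x y. f (P x y) * Px x y)
        = box ?a ?b (\<lambda>x y. - 2 * v0 * (f (P x y) * Px x y))" by simp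
    also have "\<dots> \<le> box ?a ?b (\<lambda>x y. M * (react x y + diss x y))"
    proof (rule box_integral_mono)
      show "- 2 * v0 * (f (P x y) * Px x y) \<le> M * (react x y + diss x y)" if "y \<in> {0..H}" for x y
      proof -
        have "- 2 * v0 * (f (P x y) * Px x y) \<le> 2 * v0 * f (P x y) * \<bar>Px x y\<bar>"
          using mult_left_mono[of "- Px x y" "\<bar>Px x y\<bar>" "2 * v0 * f (P x y)"] f_nonneg range that pos
          by (auto simp: algebra_simps)
        also have "\<dots> \<le> M * (react x y + diss x y)"
          by (rule mixed_le_energy) (use M range that in auto)
        finally show ?thesis .
      qed
    qed (rule continuous_on_subset[OF _ s], intro continuous_intros fc cont continuous_comp f_cont react_cont diss_cont)+
    also have "\<dots> = M * (box ?a ?b react + box ?a ?b diss)"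
      using box_integral_add[OF continuous_on_subset[OF react_cont s] continuous_on_subset[OF diss_cont s]]
      by simp
    also have "\<dots> \<le> M * (2 * rate)"
      using box_react_le_rate[of ?a ?b] box_diss_le_rate[of ?a ?b] M by (intro mult_left_mono) auto
    finally show ?thesis .
  qed
  have "- 2 * v0 * (G 0 * integral {0..H} (\<lambda>y. 1) - G 1 * integral {0..H} (\<lambda>y. 1)) \<le> M * (2 * rate)"
    by (rule LIMSEQ_le_const2[OF L]) (use le in blast)
  then show ?thesis using pos by (simp add: algebra_simps)
qed


text \<open>The cross-sections supplied by \<open>flux_limit\<close> depend on the interval. The
  bound on \<open>X n\<close> is therefore enlarged to the box from \<open>- real n - 1\<close> to
  \<open>real n + 1\<close>, common to all intervals, so that bounds for different intervals can be
  added before the limit is taken.\<close>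

lemma interval_flux_bound:
  assumes M: "1 \<le> M" "\<And>s. s \<in> {0..1} \<Longrightarrow> f s \<le> M" "\<And>s. s \<in> {0..1} \<Longrightarrow> \<bar>f' s\<bar> \<le> M"
    and G: "\<And>s. s \<in> {0..1} \<Longrightarrow> (G has_real_derivative f s) (at s within {0..1})"
    and h: "0 < h" and sub: "{c - h..c + h} \<subseteq> {0..H}"
  obtains X where
    "X \<longlonglongrightarrow> (G 1 - G 0) * integral {c - h..c + h} (\<lambda>y. (1 - ((y - c) / h)\<^sup>2) * u y)"
    "\<And>n. \<bar>X n\<bar> \<le> M * (1 + (\<kappa> / v0) / h) *
        integral {- real n - 1..real n + 1} (\<lambda>x. integral {c - h..c + h} (energy x))"
proof -
  let ?p = "c - h" and ?q = "c + h"
  define \<phi> where "\<phi> y = 1 - ((y - c) / h)\<^sup>2" for y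
  define \<phi>' where "\<phi>' y = - (2 * (y - c) / h\<^sup>2)" for y
  have \<phi>'c: "continuous_on {?p..?q} \<phi>'" unfolding \<phi>'_def by (intro continuous_intros) (use h in auto)
  have \<phi>d: "(\<phi> has_real_derivative \<phi>' y) (at y within {?p..?q})" for y
    unfolding \<phi>_def \<phi>'_def
    using h by (auto intro!: derivative_eq_intros simp: power2_eq_square field_simps)
  have \<phi>c: "continuous_on {?p..?q} \<phi>" by (rule DERIV_continuous_on[OF \<phi>d])
  define E where "E x y = \<phi> y * (f (P x y) * (Pt x y - v0\<^sup>2 / \<kappa> * f (P x y)))
        + \<kappa> * (\<phi> y * (f' (P x y) * ((Px x y)\<^sup>2 + (Py x y)\<^sup>2)))
        + \<kappa> * (\<phi>' y * (f (P x y) * Py x y))" for x y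
  obtain a b where ab: "\<And>n. a n \<in> {- real n - 1..- real n}" "\<And>n. b n \<in> {real n..real n + 1}"
    and L: "(\<lambda>n. integral {a n..b n} (\<lambda>x. integral {?p..?q} (E x)))
      \<longlonglongrightarrow> (G 1 - G 0) * integral {?p..?q} (\<lambda>y. \<phi> y * u y)"
    unfolding E_def
    by (rule flux_limit[of G f f' ?p ?q \<phi> \<phi>', OF G f f' \<phi>d \<phi>'c])
      (use h sub in \<open>auto simp: \<phi>_def\<close>)
  define k where "k = M * (1 + (\<kappa> / v0) / h)"
  have k0: "0 \<le> k" using M h pos by (simp add: k_def)
  have E_le: "\<bar>E x y\<bar> \<le> k * energy x y" if y: "y \<in> {?p..?q}" for x y
  proof -
    have yH: "y \<in> {0..H}" using y sub by auto
    have Pr: "P x y \<in> {0..1}" using range[OF yH] .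
    have fP: "0 \<le> f (P x y)" "f (P x y) \<le> M" "\<bar>f' (P x y)\<bar> \<le> M" using f_nonneg M Pr by auto
    have yh: "\<bar>y - c\<bar> \<le> h" using y by auto
    have "\<bar>(y - c) / h\<bar> \<le> 1" using yh h by (simp add: abs_divide)
    then have \<phi>1: "0 \<le> \<phi> y" "\<phi> y \<le> 1" unfolding \<phi>_def by (simp_all add: abs_square_le_1)
    have 1: "\<bar>\<phi> y * (f (P x y) * (Pt x y - v0\<^sup>2 / \<kappa> * f (P x y)))\<bar> \<le> 1 * (M * (Pt x y + react x y))"
      unfolding abs_mult react_def[symmetric]
      using \<phi>1 fP Pt_nonneg[OF yH, of x] react_nonneg[OF yH, of x] by (intro mult_mono) auto
    have "\<bar>\<kappa> * (\<phi> y * (f' (P x y) * ((Px x y)\<^sup>2 + (Py x y)\<^sup>2)))\<bar> = \<phi> y * (\<bar>f' (P x y)\<bar> * diss x y)"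
      using pos \<phi>1 by (simp add: abs_mult diss_def)
    also have "\<dots> \<le> 1 * (M * diss x y)"
      using \<phi>1 fP diss_nonneg[of x y] by (intro mult_mono) auto
    finally have 2: "\<bar>\<kappa> * (\<phi> y * (f' (P x y) * ((Px x y)\<^sup>2 + (Py x y)\<^sup>2)))\<bar> \<le> M * diss x y" by simp
    have \<phi>'b: "\<bar>\<phi>' y\<bar> \<le> 2 / h"
    proof -
      have "\<bar>\<phi>' y\<bar> = 2 * \<bar>y - c\<bar> / h\<^sup>2" unfolding \<phi>'_def abs_minus_cancel abs_divide abs_mult by simp
      also have "\<dots> \<le> 2 * h / h\<^sup>2" using yh h by (intro divide_right_mono mult_left_mono) auto
      also have "\<dots> = 2 / h" using h by (simp add: power2_eq_square)
      finally show ?thesis .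
    qed
    have "\<bar>\<kappa> * (\<phi>' y * (f (P x y) * Py x y))\<bar> = \<bar>\<phi>' y\<bar> * (\<kappa> * (f (P x y) * \<bar>Py x y\<bar>))"
      using pos fP by (simp add: abs_mult)
    also have "\<dots> \<le> 2 / h * (\<kappa> * (f (P x y) * \<bar>Py x y\<bar>))"
      using \<phi>'b pos fP by (intro mult_right_mono) auto
    \<comment> \<open>The 2 from \<open>\<bar>\<phi>' y\<bar> \<le> 2 / h\<close> is exactly the 2
      of AM-GM, so l / h appears with coefficient 1.\<close>
    also have "\<dots> = (\<kappa> / v0) / h * (2 * v0 * f (P x y) * \<bar>Py x y\<bar>)" using pos h by (simp add: field_simps)
    also have "\<dots> \<le> (\<kappa> / v0) / h * (M * (react x y + diss x y))"
      by (intro mult_left_mono mixed_le_energy) (use pos h fP M yH in auto)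
    also have "\<dots> \<le> (\<kappa> / v0) / h * (M * energy x y)"
      using Pt_nonneg[OF yH] M pos h by (intro mult_left_mono) (auto simp: energy_def)
    finally have 3: "\<bar>\<kappa> * (\<phi>' y * (f (P x y) * Py x y))\<bar> \<le> (\<kappa> / v0) / h * (M * energy x y)" .
    have "\<bar>E x y\<bar> \<le> M * (Pt x y + react x y) + M * diss x y + (\<kappa> / v0) / h * (M * energy x y)"
      unfolding E_def using 1 2 3 by linarith
    also have "\<dots> = k * energy x y" by (simp add: k_def energy_def algebra_simps)
    finally show ?thesis .
  qed
  define X where "X n = integral {a n..b n} (\<lambda>x. integral {?p..?q} (E x))" for n
  have X_le: "\<bar>X n\<bar> \<le> k * integral {- real n - 1..real n + 1} (\<lambda>x. integral {?p..?q} (energy x))" for n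
  proof -
    have s: "{a n..b n} \<times> {?p..?q} \<subseteq> UNIV \<times> {0..H}" using sub by auto
    have s': "{- real n - 1..real n + 1} \<times> {?p..?q} \<subseteq> UNIV \<times> {0..H}" using sub by auto
    have snd: "continuous_on ({a n..b n} \<times> {?p..?q}) (\<lambda>z. \<psi> (snd z))" if "continuous_on {?p..?q} \<psi>" for \<psi> :: "real \<Rightarrow> real"
      by (rule continuous_on_compose2[OF that]) (auto intro!: continuous_intros)
    note cs = continuous_on_subset[OF cont(2) s] continuous_on_subset[OF cont(3) s]
      continuous_on_subset[OF cont(4) s] continuous_on_subset[OF continuous_comp[OF f_cont] s]
      continuous_on_subset[OF continuous_comp[OF f'] s] continuous_on_subset[OF energy_cont s]
    have Ec: "continuous_on ({a n..b n} \<times> {?p..?q}) (\<lambda>z. E (fst z) (snd z))"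
      unfolding E_def by (intro continuous_intros snd cs \<phi>c \<phi>'c)
    have kc: "continuous_on ({a n..b n} \<times> {?p..?q}) (\<lambda>z. k * energy (fst z) (snd z))"
      by (intro continuous_intros cs)
    have "X n \<le> integral {a n..b n} (\<lambda>x. integral {?p..?q} (\<lambda>y. k * energy x y))"
      unfolding X_def by (rule box_integral_mono[OF Ec kc]) (use E_le in \<open>auto simp: abs_le_iff\<close>)
    moreover have "integral {a n..b n} (\<lambda>x. integral {?p..?q} (\<lambda>y. - (k * energy x y))) \<le> X n"
      unfolding X_def
    proof (rule box_integral_mono[OF continuous_on_minus[OF kc] Ec])
      show "- (k * energy x y) \<le> E x y" if "y \<in> {?p..?q}" for x y
        using E_le[OF that, of x] by linarith
    qed
    ultimately have "\<bar>X n\<bar> \<le> k * integral {a n..b n} (\<lambda>x. integral {?p..?q} (energy x))"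
      by (simp add: abs_le_iff)
    also have "\<dots> \<le> k * integral {- real n - 1..real n + 1} (\<lambda>x. integral {?p..?q} (energy x))"
      using k0 ab(1)[of n] ab(2)[of n] sub
      by (intro mult_left_mono box_integral_subset continuous_on_subset[OF energy_cont s'] energy_nonneg) auto
    finally show ?thesis .
  qed
  have "X \<longlonglongrightarrow> (G 1 - G 0) * integral {?p..?q} (\<lambda>y. (1 - ((y - c) / h)\<^sup>2) * u y)"
    using L unfolding X_def \<phi>_def .
  then show ?thesis by (rule that[OF _ X_le[unfolded k_def]])
qed

text \<open>The weight \<open>inverse (1 + (\<kappa> / v0) / h j)\<close> cancels the loss in the
  bound for one interval. What is left is the energy on disjoint substrips, whose sum is at most the
  energy of the whole strip.\<close>

lemma intervals_flux_bound:
  assumes M: "1 \<le> M" "\<And>s. s \<in> {0..1} \<Longrightarrow> f s \<le> M" "\<And>s. s \<in> {0..1} \<Longrightarrow> \<bar>f' s\<bar> \<le> M"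
    and G: "\<And>s. s \<in> {0..1} \<Longrightarrow> (G has_real_derivative f s) (at s within {0..1})"
    and F: "finite F" "disjoint_family_on (\<lambda>j. {c j - h j<..<c j + h j}) F"
    and h: "\<And>j. j \<in> F \<Longrightarrow> 0 < h j" and sub: "\<And>j. j \<in> F \<Longrightarrow> {c j - h j..c j + h j} \<subseteq> {0..H}"
  shows "(\<Sum>j\<in>F. inverse (1 + (\<kappa> / v0) / h j) *
       \<bar>(G 1 - G 0) * integral {c j - h j..c j + h j} (\<lambda>y. (1 - ((y - c j) / h j)\<^sup>2) * u y)\<bar>) \<le> M * (3 * rate)"
proof -
  let ?W = "\<lambda>j n. integral {- real n - 1..real n + 1} (\<lambda>x. integral {c j - h j..c j + h j} (energy x))"
  let ?B = "\<lambda>j. (G 1 - G 0) * integral {c j - h j..c j + h j} (\<lambda>y. (1 - ((y - c j) / h j)\<^sup>2) * u y)"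
  let ?k = "\<lambda>j. 1 + (\<kappa> / v0) / h j"
  have "\<forall>j\<in>F. \<exists>X. X \<longlonglongrightarrow> ?B j \<and> (\<forall>n. \<bar>X n\<bar> \<le> M * ?k j * ?W j n)"
  proof
    fix j assume j: "j \<in> F"
    show "\<exists>X. X \<longlonglongrightarrow> ?B j \<and> (\<forall>n. \<bar>X n\<bar> \<le> M * ?k j * ?W j n)"
      by (rule interval_flux_bound[OF M G h[OF j] sub[OF j]]) blast+
  qed
  then obtain X where X: "\<And>j. j \<in> F \<Longrightarrow> X j \<longlonglongrightarrow> ?B j"
    "\<And>j n. j \<in> F \<Longrightarrow> \<bar>X j n\<bar> \<le> M * ?k j * ?W j n"
    unfolding bchoice_iff by blast
  have kpos: "0 < ?k j" if "j \<in> F" for j using h[OF that] pos by (simp add: add_pos_pos)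
  have lim: "(\<lambda>n. \<Sum>j\<in>F. inverse (?k j) * \<bar>X j n\<bar>) \<longlonglongrightarrow> (\<Sum>j\<in>F. inverse (?k j) * \<bar>?B j\<bar>)"
    by (intro tendsto_intros X)
  have le: "(\<Sum>j\<in>F. inverse (?k j) * \<bar>X j n\<bar>) \<le> M * (3 * rate)" for n
  proof -
    have W_int: "(\<lambda>x. integral {c j - h j..c j + h j} (energy x)) integrable_on {- real n - 1..real n + 1}"
      if "j \<in> F" for j
    proof -
      have "{- real n - 1..real n + 1} \<times> {c j - h j..c j + h j} \<subseteq> UNIV \<times> {0..H}"
        using sub[OF that] by (intro Sigma_mono) auto
      then show ?thesis
        by (intro integrable_continuous_real continuous_on_inner_integral continuous_on_subset[OF energy_cont])
    qed
    have "(\<Sum>j\<in>F. inverse (?k j) * \<bar>X j n\<bar>) \<le> (\<Sum>j\<in>F. M * ?W j n)"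
    proof (rule sum_mono)
      fix j assume j: "j \<in> F"
      have "inverse (?k j) * \<bar>X j n\<bar> \<le> inverse (?k j) * (M * ?k j * ?W j n)"
        using X(2)[OF j] kpos[OF j] by (intro mult_left_mono) auto
      also have "\<dots> = M * ?W j n" using kpos[OF j] by (simp add: field_simps)
      finally show "inverse (?k j) * \<bar>X j n\<bar> \<le> M * ?W j n" .
    qed
    also have "\<dots> = M * (\<Sum>j\<in>F. ?W j n)" by (simp add: sum_distrib_left)
    also have "(\<Sum>j\<in>F. ?W j n) =
        integral {- real n - 1..real n + 1} (\<lambda>x. \<Sum>j\<in>F. integral {c j - h j..c j + h j} (energy x))"
      by (rule integral_sum[OF F(1) W_int, symmetric])
    also have "\<dots> \<le> box (- real n - 1) (real n + 1) energy"
    proof (rule integral_le)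
      show "(\<lambda>x. \<Sum>j\<in>F. integral {c j - h j..c j + h j} (energy x)) integrable_on {- real n - 1..real n + 1}"
        by (rule integrable_sum[OF F(1) W_int])
      show "(\<lambda>x. integral {0..H} (energy x)) integrable_on {- real n - 1..real n + 1}"
        by (intro integrable_continuous_real continuous_on_inner_integral
            continuous_on_subset[OF energy_cont]) auto
      show "(\<Sum>j\<in>F. integral {c j - h j..c j + h j} (energy x)) \<le> integral {0..H} (energy x)" for x
        by (rule sum_integral_disjoint_intervals[OF F sub continuous_on_slice_snd[OF energy_cont]])
          (use energy_nonneg in auto)
    qed
    also have "\<dots> \<le> 3 * rate" by (rule box_energy_le_rate)
    finally show ?thesis using M(1) by simp
  qed
  show ?thesis by (rule LIMSEQ_le_const2[OF lim]) (use le in blast)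
qed

end

section \<open>Comparison for the reactive front\<close>

lemma twice_differentiable_stripD:
  assumes "twice_differentiable_strip H g" "0 < H" "y \<in> {0..H}"
  shows "((\<lambda>s. g s y) has_real_derivative Dx g x y) (at x)"
    and "((\<lambda>s. Dx g s y) has_real_derivative Dx (Dx g) x y) (at x)"
    and "(g x has_real_derivative Dy H g x y) (at y within {0..H})"
    and "(Dy H g x has_real_derivative Dy H (Dy H g) x y) (at y within {0..H})"
proof -
  have d: "(\<lambda>s. g s y) differentiable (at x)" "(\<lambda>s. Dx g s y) differentiable (at x)"
    "g x differentiable (at y within {0..H})" "Dy H g x differentiable (at y within {0..H})"
    using assms unfolding twice_differentiable_strip_def by auto
  show "((\<lambda>s. g s y) has_real_derivative Dx g x y) (at x)"
    using d(1) by (simp add: Dx_def DERIV_deriv_iff_real_differentiable)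
  show "((\<lambda>s. Dx g s y) has_real_derivative Dx (Dx g) x y) (at x)"
    using d(2) by (simp add: Dx_def[of "Dx g"] DERIV_deriv_iff_real_differentiable)
  show "(g x has_real_derivative Dy H g x y) (at y within {0..H})"
    using d(3) by (simp add: Dy_def vector_derivative_works has_real_derivative_iff_has_vector_derivative)
  show "(Dy H g x has_real_derivative Dy H (Dy H g) x y) (at y within {0..H})"
    using d(4) by (simp add: Dy_def[of H "Dy H g"] vector_derivative_works has_real_derivative_iff_has_vector_derivative)
qed

lemma Dy_eqI:
  assumes "0 < H" "y \<in> {0..H}" "(g x has_real_derivative d) (at y within {0..H})"
  shows "Dy H g x y = d"
  unfolding Dy_def
  using assms by (intro vector_derivative_within_closed_interval)
    (auto simp: has_real_derivative_iff_has_vector_derivative)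

text \<open>The periodic extension has a two-sided derivative at 0, and translation by
  \<open>H\<close> carries it to \<open>H\<close>; at both points it agrees with the one-sided
  derivative that \<open>Dy\<close> takes.\<close>

lemma periodic_bc_Dy:
  assumes "0 < H" "periodic_bc H T" "0 \<le> t"
  shows "Dy H (\<lambda>x y. T x y t) x 0 = Dy H (\<lambda>x y. T x y t) x H"
proof -
  let ?p = "\<lambda>y. T x y t"
  have per: "?p (y + H) = ?p y" for y using assms by (auto simp: periodic_bc_def)
  have "?p differentiable (at 0)"
    using assms by (auto simp: periodic_bc_def differentiable_on_def)
  then have d0: "(?p has_real_derivative deriv ?p 0) (at 0)"
    by (simp add: DERIV_deriv_iff_real_differentiable)
  have "((\<lambda>y. ?p (y + H)) has_real_derivative deriv ?p 0) (at 0)" using d0 by (simp add: per)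
  then have dH: "(?p has_real_derivative deriv ?p 0) (at (0 + H))" by (simp only: DERIV_shift)
  show ?thesis
    using Dy_eqI[of H 0 "\<lambda>x y. T x y t" x "deriv ?p 0"] Dy_eqI[of H H "\<lambda>x y. T x y t" x "deriv ?p 0"]
      has_field_derivative_at_within[OF d0] has_field_derivative_at_within[OF dH] \<open>0 < H\<close> by simp
qed

section \<open>The evolving solution: ordering in time, tails, and its snapshots\<close>

locale reactive_front =
  fixes \<kappa> v0 H :: real and f f' u :: "real \<Rightarrow> real" and T0 :: "real \<Rightarrow> real \<Rightarrow> real"
    and T :: "real \<Rightarrow> real \<Rightarrow> real \<Rightarrow> real" and M :: real
  assumes pos: "0 < \<kappa>" "0 < v0" "0 < H"
    and f: "\<And>s. s \<in> {0..1} \<Longrightarrow> (f has_real_derivative f' s) (at s within {0..1})"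
    and f': "continuous_on {0..1} f'" "\<And>s. s \<in> {0..1} \<Longrightarrow> \<bar>f' s\<bar> \<le> M"
    and f_nonneg: "\<And>s. s \<in> {0..1} \<Longrightarrow> 0 \<le> f s" and f_ends: "f 0 = 0" "f 1 = 0"
    and u: "C1_on 0 H u" "integral {0..H} u = 0"
    and initial: "admissible_initial_data \<kappa> v0 H f u T0"
    and solution: "reactive_solution \<kappa> v0 H f u T0 T"
begin

abbreviation Tt :: "real \<Rightarrow> real \<Rightarrow> real \<Rightarrow> real" where
  "Tt x y t \<equiv> deriv (T x y) t"

abbreviation Tx :: "real \<Rightarrow> real \<Rightarrow> real \<Rightarrow> real" where
  "Tx x y t \<equiv> Dx (\<lambda>x y. T x y t) x y"

abbreviation Txx :: "real \<Rightarrow> real \<Rightarrow> real \<Rightarrow> real" where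
  "Txx x y t \<equiv> Dx (Dx (\<lambda>x y. T x y t)) x y"

abbreviation Ty :: "real \<Rightarrow> real \<Rightarrow> real \<Rightarrow> real" where
  "Ty x y t \<equiv> Dy H (\<lambda>x y. T x y t) x y"

abbreviation Tyy :: "real \<Rightarrow> real \<Rightarrow> real \<Rightarrow> real" where
  "Tyy x y t \<equiv> Dy H (Dy H (\<lambda>x y. T x y t)) x y"

definition rlip :: real where "rlip = v0\<^sup>2 / \<kappa> * M"

lemma M_nonneg: "0 \<le> M" using f'(2)[of 0] by simp

lemma rlip_nonneg: "0 \<le> rlip" using M_nonneg pos by (simp add: rlip_def)

lemma f_lipschitz: "r \<in> {0..1} \<Longrightarrow> s \<in> {0..1} \<Longrightarrow> \<bar>f r - f s\<bar> \<le> M * \<bar>r - s\<bar>"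
  using field_differentiable_bound[of "{0..1}" f f' M r s] f f'(2) by simp

definition reaction :: "real \<Rightarrow> real" where "reaction r = v0\<^sup>2 / \<kappa> * f r"

lemma reaction_lipschitz:
  assumes "r \<in> {0..1}" "s \<in> {0..1}"
  shows "\<bar>reaction r - reaction s\<bar> \<le> rlip * \<bar>r - s\<bar>"
proof -
  have "\<bar>reaction r - reaction s\<bar> = v0\<^sup>2 / \<kappa> * \<bar>f r - f s\<bar>"
    unfolding reaction_def right_diff_distrib[symmetric] abs_mult using pos by simp
  also have "\<dots> \<le> v0\<^sup>2 / \<kappa> * (M * \<bar>r - s\<bar>)"
    using f_lipschitz[OF assms] pos by (intro mult_left_mono) auto
  finally show ?thesis by (simp add: rlip_def mult.assoc)
qed

lemma T_range: "y \<in> {0..H} \<Longrightarrow> 0 \<le> t \<Longrightarrow> T x y t \<in> {0..1}"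
  using solution by (auto simp: reactive_solution_def)

lemma T_initial: "y \<in> {0..H} \<Longrightarrow> T x y 0 = T0 x y"
  using solution by (auto simp: reactive_solution_def)

lemma T0_range: "y \<in> {0..H} \<Longrightarrow> T0 x y \<in> {0..1}"
  using T_range[of y 0 x] T_initial by simp

lemma T_eqn: "y \<in> {0..H} \<Longrightarrow> 0 < t \<Longrightarrow>
    Tt x y t + u y * Tx x y t = \<kappa> * (Txx x y t + Tyy x y t) + reaction (T x y t)"
  using solution by (auto simp: reactive_solution_def laplacian_def reaction_def)

lemma T_strip: "0 < t \<Longrightarrow> twice_differentiable_strip H (\<lambda>x y. T x y t)"
  using solution by (auto simp: reactive_solution_def classical_regularity_def)

lemma T_dt: "y \<in> {0..H} \<Longrightarrow> 0 < t \<Longrightarrow> (T x y has_real_derivative Tt x y t) (at t)"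
  using solution
  by (auto simp: reactive_solution_def classical_regularity_def DERIV_deriv_iff_real_differentiable)

lemmas T_dx = twice_differentiable_stripD(1)[OF T_strip pos(3)]
lemmas T_dxx = twice_differentiable_stripD(2)[OF T_strip pos(3)]
lemmas T_dy = twice_differentiable_stripD(3)[OF T_strip pos(3)]
lemmas T_dyy = twice_differentiable_stripD(4)[OF T_strip pos(3)]

lemma T_cont: "continuous_on (UNIV \<times> {0..H} \<times> {0..}) (\<lambda>(x, y, t). T x y t)"
  using solution by (auto simp: reactive_solution_def classical_regularity_def)

lemma T0_strip: "twice_differentiable_strip H T0"
  using initial by (auto simp: admissible_initial_data_def C2_strip_def)

lemmas T0_d = twice_differentiable_stripD[OF T0_strip pos(3)]

lemma T0_subsolution: "y \<in> {0..H} \<Longrightarrow>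
    0 \<le> \<kappa> * (Dx (Dx T0) x y + Dy H (Dy H T0) x y) - u y * Dx T0 x y + reaction (T0 x y)"
  using initial by (auto simp: admissible_initial_data_def laplacian_def reaction_def)

text \<open>The disjunction stands outside the quantifiers on purpose. The comparison functions are
  differences of two profiles, and \<open>matching_ends\<close> passes to a difference only if both
  profiles satisfy the same alternative.\<close>

lemma boundary_alternatives:
  "(\<forall>x. \<forall>t\<ge>0. Ty x 0 t = 0 \<and> Ty x H t = 0) \<or>
   (\<forall>x. \<forall>t\<ge>0. T x 0 t = T x H t \<and> Ty x 0 t = Ty x H t)"
proof -
  have "neumann_bc H T \<or> periodic_bc H T" using solution by (auto simp: reactive_solution_def)
  then show ?thesis
  proof
    assume per: "periodic_bc H T"
    then have "T x 0 t = T x H t" if "0 \<le> t" for x t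
      using that unfolding periodic_bc_def by (metis add_0)
    then show ?thesis using periodic_bc_Dy[OF pos(3) per] by blast
  qed (auto simp: neumann_bc_def)
qed

text \<open>Carries the boundary conditions of the solution at \<open>t = 0\<close> over to
  \<open>T0\<close>, as needed to compare \<open>T\<close> with it.\<close>

lemma T0_Dy: "y \<in> {0..H} \<Longrightarrow> Ty x y 0 = Dy H T0 x y"
proof (rule Dy_eqI[OF pos(3)])
  assume y: "y \<in> {0..H}"
  show "((\<lambda>y. T x y 0) has_real_derivative Dy H T0 x y) (at y within {0..H})"
    using T0_d(3)[OF y, of x] has_derivative_transform[OF y, of "\<lambda>y. T x y 0" "T0 x"] T_initial
    unfolding has_field_derivative_def by blast
qed

lemma u_cont: "continuous_on {0..H} u"
proof -
  obtain u' where "\<forall>y\<in>{0..H}. (u has_real_derivative u' y) (at y within {0..H})"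
    using u(1) unfolding C1_on_def by blast
  then show ?thesis by (intro DERIV_continuous_on) auto
qed

lemma u_bounded: obtains U where "\<And>y. y \<in> {0..H} \<Longrightarrow> \<bar>u y\<bar> \<le> U"
  using that continuous_on_Icc_bounded[OF u_cont] by blast

lemma T_shift_cont:
  assumes "0 \<le> s"
  shows "continuous_on (UNIV \<times> {0..H} \<times> {0..\<tau>}) (\<lambda>(x, y, t). T x y (t + s))"
proof -
  have "continuous_on (UNIV \<times> {0..H} \<times> {0..\<tau>})
     (\<lambda>z. (\<lambda>(x, y, t). T x y t) (fst z, fst (snd z), snd (snd z) + s))"
    by (rule continuous_on_compose2[OF T_cont]) (use assms in \<open>auto intro!: continuous_intros\<close>)
  then show ?thesis by (simp add: case_prod_beta)
qed

lemma T0_cont: "continuous_on (UNIV \<times> {0..H} \<times> {0..\<tau>}) (\<lambda>(x, y, t). T0 x y)"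
proof -
  have c: "continuous_on (UNIV \<times> {0..H}) (\<lambda>(x, y). T0 x y)"
    using initial by (auto simp: admissible_initial_data_def C2_strip_def)
  have "continuous_on (UNIV \<times> {0..H} \<times> {0..\<tau>}) (\<lambda>z. (\<lambda>(x, y). T0 x y) (fst z, fst (snd z)))"
    by (rule continuous_on_compose2[OF c]) (auto intro!: continuous_intros)
  then show ?thesis by (simp add: case_prod_beta)
qed

lemma T_ge_T0:
  assumes y: "y \<in> {0..H}" and t: "0 \<le> t"
  shows "T0 x y \<le> T x y t"
proof -
  obtain U where U: "\<And>y. y \<in> {0..H} \<Longrightarrow> \<bar>u y\<bar> \<le> U" using u_bounded by blast
  have "0 \<le> T x y t - T0 x y"
  proof (rule strip_minimum_principle[where H=H and \<kappa>=\<kappa> and L=rlip and \<tau>=t and B=1 and u=u and U=U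
        and w="\<lambda>x y t. T x y t - T0 x y" and wt=Tt and wx="\<lambda>x y t. Tx x y t - Dx T0 x y"
        and wxx="\<lambda>x y t. Txx x y t - Dx (Dx T0) x y" and wy="\<lambda>x y t. Ty x y t - Dy H T0 x y"
        and wyy="\<lambda>x y t. Tyy x y t - Dy H (Dy H T0) x y"])
    show "continuous_on (UNIV \<times> {0..H} \<times> {0..t}) (\<lambda>(x, y, t). T x y t - T0 x y)"
      using continuous_on_diff[OF T_shift_cont[of 0 t] T0_cont[of t]] by (simp add: case_prod_beta)
    show "- 1 \<le> T x y t - T0 x y" if "y \<in> {0..H}" "t \<in> {0..\<tau>}" for x y t \<tau>
      using T_range[of y t x] T0_range[of y x] that by auto
    show "0 \<le> T x y 0 - T0 x y" if "y \<in> {0..H}" for x y using T_initial[OF that] by simp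
    show "((\<lambda>t. T x y t - T0 x y) has_real_derivative Tt x y t) (at t)" if "y \<in> {0..H}" "0 < t" for x y t
      using DERIV_diff[OF T_dt[OF that] DERIV_const] by simp
    show "matching_ends H (\<lambda>y. T x y t - T0 x y) (\<lambda>y. Ty x y t - Dy H T0 x y)" if "0 < t" for x t
      using boundary_alternatives
    proof
      assume "\<forall>x. \<forall>t\<ge>0. Ty x 0 t = 0 \<and> Ty x H t = 0"
      then have "Ty x 0 t = 0 \<and> Ty x H t = 0" "Ty x 0 0 = 0 \<and> Ty x H 0 = 0" using that by auto
      then show ?thesis using T0_Dy[of 0 x] T0_Dy[of H x] pos by (auto simp: matching_ends_def)
    next
      assume "\<forall>x. \<forall>t\<ge>0. T x 0 t = T x H t \<and> Ty x 0 t = Ty x H t"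
      then have "T x 0 t = T x H t \<and> Ty x 0 t = Ty x H t" "T x 0 0 = T x H 0 \<and> Ty x 0 0 = Ty x H 0"
        using that by auto
      then show ?thesis
        using T0_Dy[of 0 x] T0_Dy[of H x] T_initial[of 0 x] T_initial[of H x] pos
        by (auto simp: matching_ends_def)
    qed
    \<comment> \<open>Where the difference is negative, the Lipschitz bound says that the difference
      of the reactions is at least \<open>rlip\<close> times it; this is the zeroth-order term of
      the minimum principle.\<close>
    show "\<kappa> * (Txx x y t - Dx (Dx T0) x y + (Tyy x y t - Dy H (Dy H T0) x y))
        - u y * (Tx x y t - Dx T0 x y) + rlip * (T x y t - T0 x y) \<le> Tt x y t"
      if "y \<in> {0..H}" "0 < t" "T x y t - T0 x y < 0" for x y t
      using T_eqn[OF that(1,2), of x] T0_subsolution[OF that(1), of x] that(3)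
        reaction_lipschitz[OF T_range[OF that(1), of t x] T0_range[OF that(1), of x]] that(2)
      by (simp add: abs_if algebra_simps split: if_splits)
  qed (use y t pos rlip_nonneg U in \<open>auto intro!: DERIV_diff T_dx T_dxx T_dy T_dyy T0_d\<close>)
  then show ?thesis by simp
qed

text \<open>\<open>Tt\<close> cannot be put into the minimum principle directly, because classical
  regularity provides no derivatives of it. The increment over a time step \<open>s\<close> solves a
  linear inequality and has the needed regularity; at time 0 it is nonnegative by
  \<open>T_ge_T0\<close>.\<close>

lemma T_mono:
  assumes y: "y \<in> {0..H}" and t: "0 \<le> t" and s: "0 \<le> s"
  shows "T x y t \<le> T x y (t + s)"
proof -
  obtain U where U: "\<And>y. y \<in> {0..H} \<Longrightarrow> \<bar>u y\<bar> \<le> U" using u_bounded by blast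
  have "0 \<le> T x y (t + s) - T x y t"
  proof (rule strip_minimum_principle[where H=H and \<kappa>=\<kappa> and L=rlip and \<tau>=t and B=1 and u=u and U=U
        and w="\<lambda>x y t. T x y (t + s) - T x y t" and wt="\<lambda>x y t. Tt x y (t + s) - Tt x y t"
        and wx="\<lambda>x y t. Tx x y (t + s) - Tx x y t"
        and wxx="\<lambda>x y t. Txx x y (t + s) - Txx x y t" and wy="\<lambda>x y t. Ty x y (t + s) - Ty x y t"
        and wyy="\<lambda>x y t. Tyy x y (t + s) - Tyy x y t"])
    show "continuous_on (UNIV \<times> {0..H} \<times> {0..t}) (\<lambda>(x, y, t). T x y (t + s) - T x y t)"
      using continuous_on_diff[OF T_shift_cont[OF s, of t] T_shift_cont[of 0 t]] by (simp add: case_prod_beta)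
    show "- 1 \<le> T x y (t + s) - T x y t" if "y \<in> {0..H}" "t \<in> {0..\<tau>}" for x y t \<tau>
      using T_range[of y t x] T_range[of y "t + s" x] that s by auto
    show "0 \<le> T x y (0 + s) - T x y 0" if "y \<in> {0..H}" for x y
      using T_initial[OF that] T_ge_T0[OF that s] by simp
    show "((\<lambda>t. T x y (t + s) - T x y t) has_real_derivative Tt x y (t + s) - Tt x y t) (at t)"
      if "y \<in> {0..H}" "0 < t" for x y t
      using T_dt[OF that(1), of "t + s" x] T_dt[OF that] s that(2)
      by (intro DERIV_diff) (auto simp: DERIV_shift)
    show "matching_ends H (\<lambda>y. T x y (t + s) - T x y t) (\<lambda>y. Ty x y (t + s) - Ty x y t)" if "0 < t" for x t
      using boundary_alternatives s that by (auto simp: matching_ends_def)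
    show "\<kappa> * (Txx x y (t + s) - Txx x y t + (Tyy x y (t + s) - Tyy x y t))
        - u y * (Tx x y (t + s) - Tx x y t) + rlip * (T x y (t + s) - T x y t) \<le> Tt x y (t + s) - Tt x y t"
      if "y \<in> {0..H}" "0 < t" "T x y (t + s) - T x y t < 0" for x y t
      using T_eqn[OF that(1,2), of x] T_eqn[OF that(1), of "t + s" x] that(2,3) s
        reaction_lipschitz[OF T_range[OF that(1), of "t + s" x] T_range[OF that(1), of t x]]
      by (simp add: abs_if algebra_simps split: if_splits)
  qed (use y t s pos rlip_nonneg U in \<open>auto intro!: DERIV_diff T_dx T_dxx T_dy T_dyy\<close>)
  then show ?thesis by simp
qed

lemma Tt_nonneg:
  assumes y: "y \<in> {0..H}" and t: "0 < t"
  shows "0 \<le> Tt x y t"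
proof (rule derivative_sign_at_min(1))
  show "(T x y has_real_derivative Tt x y t) (at t within {t..t + 1})"
    by (rule has_field_derivative_at_within[OF T_dt[OF y t]])
  show "T x y t \<le> T x y s" if "s \<in> {t..t + 1}" for s
    using T_mono[OF y, of t "s - t" x] t that by simp
qed auto

text \<open>A travelling exponential is a supersolution once it moves fast enough. The condition
  \<open>1 \<le> N\<close> puts it above 1, hence above the initial data, for
  \<open>x \<le> 0\<close>.\<close>

lemma T_right_tail:
  assumes lam: "0 < lam" and N: "1 \<le> N"
    and T0: "\<And>x y. 0 < x \<Longrightarrow> y \<in> {0..H} \<Longrightarrow> T0 x y \<le> N * exp (- lam * x)"
  obtains K where "0 \<le> K" "\<And>x y t. y \<in> {0..H} \<Longrightarrow> 0 \<le> t \<Longrightarrow> T x y t \<le> N * exp (K * t - lam * x)"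
proof -
  obtain U where U: "\<And>y. y \<in> {0..H} \<Longrightarrow> \<bar>u y\<bar> \<le> U" using u_bounded by blast
  \<comment> \<open>The three terms pay for diffusion, for advection at the worst sign of
    \<open>u\<close>, and for the reaction, which is at most \<open>rlip * T\<close> because
    \<open>f 0 = 0\<close>.\<close>
  define K where "K = \<kappa> * lam\<^sup>2 + U * lam + rlip"
  have U0: "0 \<le> U" using U[of 0] pos by auto
  have K: "0 \<le> K" using U0 rlip_nonneg pos lam by (simp add: K_def)
  have "0 \<le> N * exp (K * t - lam * x) - T x y t" if y: "y \<in> {0..H}" and t: "0 \<le> t" for x y t
  proof (rule strip_minimum_principle[where H=H and \<kappa>=\<kappa> and L=rlip and \<tau>=t and B=1 and u=u and U=U
        and w="\<lambda>x y t. N * exp (K * t - lam * x) - T x y t" and wt="\<lambda>x y t. K * (N * exp (K * t - lam * x)) - Tt x y t"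
        and wx="\<lambda>x y t. - lam * (N * exp (K * t - lam * x)) - Tx x y t"
        and wxx="\<lambda>x y t. lam\<^sup>2 * (N * exp (K * t - lam * x)) - Txx x y t" and wy="\<lambda>x y t. 0 - Ty x y t"
        and wyy="\<lambda>x y t. 0 - Tyy x y t"])
    show "continuous_on (UNIV \<times> {0..H} \<times> {0..t}) (\<lambda>(x, y, t). N * exp (K * t - lam * x) - T x y t)"
      using T_shift_cont[of 0 t] unfolding case_prod_beta by (intro continuous_intros) simp
    show "- 1 \<le> N * exp (K * t - lam * x) - T x y t" if "y \<in> {0..H}" "t \<in> {0..\<tau>}" for x y t \<tau>
    proof -
      have "0 \<le> N * exp (K * t - lam * x)" using N by simp
      then show ?thesis using T_range[of y t x] that by auto
    qed
    show "0 \<le> N * exp (K * 0 - lam * x) - T x y 0" if "y \<in> {0..H}" for x y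
    proof (cases "0 < x")
      case True
      then show ?thesis using T0[OF True that] T_initial[OF that] by simp
    next
      case False
      then have "1 * 1 \<le> N * exp (- lam * x)" using N lam by (intro mult_mono) (auto simp: mult_le_0_iff)
      then show ?thesis using T_range[OF that, of 0 x] by simp
    qed
    show "((\<lambda>t. N * exp (K * t - lam * x) - T x y t) has_real_derivative
        K * (N * exp (K * t - lam * x)) - Tt x y t) (at t)" if "y \<in> {0..H}" "0 < t" for x y t
      by (rule derivative_eq_intros T_dt[OF that] refl | simp)+
    show "((\<lambda>x. N * exp (K * t - lam * x) - T x y t) has_real_derivative
        - lam * (N * exp (K * t - lam * x)) - Tx x y t) (at x)" if "y \<in> {0..H}" "0 < t" for x y t
      by (rule derivative_eq_intros T_dx[OF that(2,1)] refl | simp)+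
    show "((\<lambda>x. - lam * (N * exp (K * t - lam * x)) - Tx x y t) has_real_derivative
        lam\<^sup>2 * (N * exp (K * t - lam * x)) - Txx x y t) (at x)" if "y \<in> {0..H}" "0 < t" for x y t
      by (rule derivative_eq_intros T_dxx[OF that(2,1)] refl | simp add: power2_eq_square)+
    show "matching_ends H (\<lambda>y. N * exp (K * t - lam * x) - T x y t) (\<lambda>y. 0 - Ty x y t)" if "0 < t" for x t
      using boundary_alternatives that by (auto simp: matching_ends_def)
    show "\<kappa> * (lam\<^sup>2 * (N * exp (K * t - lam * x)) - Txx x y t + (0 - Tyy x y t))
        - u y * (- lam * (N * exp (K * t - lam * x)) - Tx x y t) + rlip * (N * exp (K * t - lam * x) - T x y t)
        \<le> K * (N * exp (K * t - lam * x)) - Tt x y t"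
      if y: "y \<in> {0..H}" and t: "0 < t" for x y t
    proof -
      define z where "z = N * exp (K * t - lam * x)"
      have z: "0 \<le> z" using N by (simp add: z_def)
      have Kz: "K * z = \<kappa> * (lam\<^sup>2 * z) + U * (lam * z) + rlip * z"
        by (simp add: K_def algebra_simps)
      have "u y * (lam * z) \<le> U * (lam * z)" using U[OF y] lam z by (intro mult_right_mono) auto
      moreover have "reaction (T x y t) \<le> rlip * T x y t"
        using reaction_lipschitz[of "T x y t" 0] T_range[OF y, of t x] t f_ends(1)
        by (auto simp: reaction_def[of 0])
      ultimately show ?thesis
        using T_eqn[OF y t, of x] Kz unfolding z_def[symmetric] by (simp add: algebra_simps)
    qed
    show "((\<lambda>s. N * exp (K * t - lam * x) - T x s t) has_real_derivative 0 - Ty x y t) (at y within {0..H})"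
      "((\<lambda>s. 0 - Ty x s t) has_real_derivative 0 - Tyy x y t) (at y within {0..H})"
      if "y \<in> {0..H}" "0 < t" for x y t
      by (intro DERIV_diff DERIV_const T_dy T_dyy that)+
  qed (use y t pos rlip_nonneg U in auto)
  then show ?thesis using that[OF K] by force
qed

text \<open>The tail of \<open>f (T x y t)\<close> uses both zeros of \<open>f\<close>. On the
  right, \<open>f r \<le> M * r\<close> meets the exponential barrier; on the left,
  \<open>f r \<le> M * (1 - r)\<close>, and the decay of \<open>1 - T0\<close> passes to
  \<open>1 - T\<close> through \<open>T_ge_T0\<close>.\<close>

lemma fixed_time_front:
  assumes t: "0 < t"
  shows "\<exists>A lam. tailed_front_profile H \<kappa> v0 f f' u (\<lambda>x y. T x y t) (\<lambda>x y. Tt x y t) (\<lambda>x y. Tx x y t)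
     (\<lambda>x y. Ty x y t) (\<lambda>x y. Txx x y t) (\<lambda>x y. Tyy x y t) A lam"
proof -
  obtain lam N where lam: "0 < lam"
    and left: "\<forall>x<0. \<forall>y\<in>{0..H}. \<bar>1 - T0 x y\<bar> \<le> N * exp (lam * x)"
    and right: "\<forall>x>0. \<forall>y\<in>{0..H}. \<bar>T0 x y\<bar> \<le> N * exp (- lam * x)"
    using initial unfolding admissible_initial_data_def by blast
  define N' where "N' = max 1 N"
  have N': "1 \<le> N'" "N * exp r \<le> N' * exp r" for r by (auto simp: N'_def)
  have "T0 x y \<le> N' * exp (- lam * x)" if "0 < x" "y \<in> {0..H}" for x y
    using right[rule_format, OF that] N'(2)[of "- lam * x"] by linarith
  then obtain K where K: "0 \<le> K" "\<And>x y t. y \<in> {0..H} \<Longrightarrow> 0 \<le> t \<Longrightarrow> T x y t \<le> N' * exp (K * t - lam * x)"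
    using T_right_tail[OF lam N'(1)] by metis
  define A where "A = M * (N' * exp (K * t))"
  have tail: "f (T x y t) \<le> A * exp (- lam * \<bar>x\<bar>)" if y: "y \<in> {0..H}" for x y
  proof -
    have Tr: "T x y t \<in> {0..1}" using T_range[OF y] t by simp
    have "\<exists>d. f (T x y t) \<le> M * d \<and> d \<le> N' * exp (K * t) * exp (- lam * \<bar>x\<bar>)"
    proof (cases "0 \<le> x")
      case True
      have "f (T x y t) \<le> M * T x y t" using f_lipschitz[OF Tr, of 0] f_ends Tr by auto
      moreover have "T x y t \<le> N' * exp (K * t) * exp (- lam * \<bar>x\<bar>)"
        using K(2)[OF y, of t x] t True by (simp add: exp_diff exp_minus field_simps)
      ultimately show ?thesis by blast
    next
      case False
      have "f (T x y t) \<le> M * (1 - T x y t)" using f_lipschitz[OF Tr, of 1] f_ends Tr by auto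
      moreover have "1 - T x y t \<le> N' * exp (K * t) * exp (- lam * \<bar>x\<bar>)"
      proof -
        have "1 - T x y t \<le> N' * exp (lam * x)"
          using T_ge_T0[OF y, of t x] t left[rule_format, OF _ y, of x] False N'(2)[of "lam * x"] by linarith
        also have "\<dots> \<le> N' * exp (K * t) * exp (lam * x)"
          using N' K(1) t by (intro mult_right_mono) auto
        finally show ?thesis using False by simp
      qed
      ultimately show ?thesis by blast
    qed
    then show ?thesis using M_nonneg unfolding A_def by (metis (no_types) mult.assoc mult_left_mono order_trans)
  qed
  have slice: "continuous_on (UNIV \<times> {0..H}) (\<lambda>z. F (fst z) (snd z) t)"
    if "continuous_on (UNIV \<times> {0..H} \<times> S) (\<lambda>(x, y, t). F x y t)" "t \<in> S" for F :: "real \<Rightarrow> real \<Rightarrow> real \<Rightarrow> real" and S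
  proof -
    have "continuous_on (UNIV \<times> {0..H}) (\<lambda>z. (\<lambda>(x, y, t). F x y t) (fst z, snd z, t))"
      by (rule continuous_on_compose2[OF that(1)]) (use that(2) in \<open>auto intro!: continuous_intros\<close>)
    then show ?thesis by simp
  qed
  have reg: "classical_regularity H T" using solution by (simp add: reactive_solution_def)
  have "tailed_front_profile H \<kappa> v0 f f' u (\<lambda>x y. T x y t) (\<lambda>x y. Tt x y t) (\<lambda>x y. Tx x y t)
     (\<lambda>x y. Ty x y t) (\<lambda>x y. Txx x y t) (\<lambda>x y. Tyy x y t) A lam"
  proof
    show "matching_ends H (\<lambda>y. T x y t) (\<lambda>y. Ty x y t)" for x
      using boundary_alternatives t by (auto simp: matching_ends_def)
    show "((\<lambda>x. T x y t) \<longlongrightarrow> 1) at_bot" "((\<lambda>x. T x y t) \<longlongrightarrow> 0) at_top" if "y \<in> {0..H}" for y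
      using solution that t by (auto simp: reactive_solution_def)
    show "Tt x y t + u y * Tx x y t = \<kappa> * (Txx x y t + Tyy x y t) + v0\<^sup>2 / \<kappa> * f (T x y t)"
      if "y \<in> {0..H}" for x y using T_eqn[OF that t] by (simp add: reaction_def)
    show "continuous_on (UNIV \<times> {0..H}) (\<lambda>z. T (fst z) (snd z) t)" by (rule slice[OF T_cont]) (use t in auto)
    show "continuous_on (UNIV \<times> {0..H}) (\<lambda>z. Tt (fst z) (snd z) t)"
      "continuous_on (UNIV \<times> {0..H}) (\<lambda>z. Tx (fst z) (snd z) t)"
      "continuous_on (UNIV \<times> {0..H}) (\<lambda>z. Ty (fst z) (snd z) t)"
      "continuous_on (UNIV \<times> {0..H}) (\<lambda>z. Txx (fst z) (snd z) t)"
      "continuous_on (UNIV \<times> {0..H}) (\<lambda>z. Tyy (fst z) (snd z) t)"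
      by (rule slice[where S="{0<..}"]; use reg t in \<open>simp add: classical_regularity_def\<close>)+
    show "T x y t \<in> {0..1}" if "y \<in> {0..H}" for x y using T_range[OF that] t by simp
  qed (fact pos f f'(1) f_nonneg u_cont u(2) lam tail Tt_nonneg[OF _ t] T_dx[OF t] T_dxx[OF t] T_dy[OF t] T_dyy[OF t])+
  then show ?thesis by blast
qed

end


section \<open>Assembly of the two contributions and choice of the constant\<close>

lemma bulk_burning_rate_bound:
  assumes f: "\<And>s. s \<in> {0..1} \<Longrightarrow> (f has_real_derivative f' s) (at s within {0..1})"
    and f': "continuous_on {0..1} f'" "\<And>s. s \<in> {0..1} \<Longrightarrow> \<bar>f' s\<bar> \<le> M"
    and f_bounds: "\<And>s. s \<in> {0..1} \<Longrightarrow> 0 \<le> f s" "\<And>s. s \<in> {0..1} \<Longrightarrow> f s \<le> M"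
    and f_ends: "f 0 = 0" "f 1 = 0" and M: "1 \<le> M"
    and G: "\<And>s. s \<in> {0..1} \<Longrightarrow> (G has_real_derivative f s) (at s within {0..1})" "G 0 < G 1"
    and pos: "0 < \<kappa>" "0 < v0" "0 < H"
    and u: "C1_on 0 H u" "integral {0..H} u = 0"
    and initial: "admissible_initial_data \<kappa> v0 H f u T0"
    and solution: "reactive_solution \<kappa> v0 H f u T0 T"
    and J: "admissible_intervals H u J c h"
    and t: "0 < t"
  shows "(G 1 - G 0) / (10 * M) * (v0 + (\<Sum>\<^sub>\<infinity>j\<in>J. inverse (1 + (\<kappa> / v0) / h j) *
            integral {c j - h j..c j + h j} (\<lambda>y. \<bar>u y\<bar> / H))) \<le> bulk_burning_rate H T t"
proof -
  interpret reactive_front \<kappa> v0 H f f' u T0 T M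
    by unfold_locales (fact f f' f_bounds f_ends pos u initial solution)+
  obtain A lam where front: "tailed_front_profile H \<kappa> v0 f f' u (\<lambda>x y. T x y t) (\<lambda>x y. Tt x y t) (\<lambda>x y. Tx x y t)
     (\<lambda>x y. Ty x y t) (\<lambda>x y. Txx x y t) (\<lambda>x y. Tyy x y t) A lam"
    using fixed_time_front[OF t] by blast
  interpret front: tailed_front_profile H \<kappa> v0 f f' u "\<lambda>x y. T x y t" "\<lambda>x y. Tt x y t" "\<lambda>x y. Tx x y t"
     "\<lambda>x y. Ty x y t" "\<lambda>x y. Txx x y t" "\<lambda>x y. Tyy x y t" A lam
    by (rule front)
  define \<gamma> where "\<gamma> = G 1 - G 0"
  have \<gamma>: "0 < \<gamma>" using G(2) by (simp add: \<gamma>_def)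
  define V where "V = bulk_burning_rate H T t"
  have "V = front.rate / H"
    unfolding V_def bulk_burning_rate_def front.rate_def case_prod_beta
    by (rule set_integral_divide_zero)
  then have V: "front.rate = H * V" using pos by simp
  have laminar: "\<gamma> * v0 \<le> M * V"
  proof -
    have "H * (\<gamma> * v0) \<le> H * (M * V)"
      using front.laminar_bound[OF M f_bounds(2) G(1)] unfolding V \<gamma>_def by (simp add: algebra_simps)
    then show ?thesis using pos by simp
  qed
  define a where "a j = inverse (1 + (\<kappa> / v0) / h j)" for j
  define b where "b j = integral {c j - h j..c j + h j} (\<lambda>y. \<bar>u y\<bar> / H)" for j
  have disj: "disjoint_family_on (\<lambda>j. {c j - h j<..<c j + h j}) J"
    and h: "0 < h j" and Ioo: "{c j - h j<..<c j + h j} \<subseteq> {0..H}"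
    and half: "\<And>y. y \<in> {c j - h j<..<c j + h j} \<Longrightarrow>
      (SUP y\<in>{c j - h j<..<c j + h j}. \<bar>u y\<bar>) / 2 \<le> \<bar>u y\<bar> \<and>
      \<bar>u y\<bar> \<le> (SUP y\<in>{c j - h j<..<c j + h j}. \<bar>u y\<bar>)" if "j \<in> J" for j
    using J that unfolding admissible_intervals_def Let_def by auto
  have Icc: "{c j - h j..c j + h j} \<subseteq> {0..H}" if "j \<in> J" for j
  proof -
    have "closure {c j - h j<..<c j + h j} \<subseteq> closure {0..H}" by (rule closure_mono[OF Ioo[OF that]])
    then show ?thesis using h[OF that] by (simp add: closure_greaterThanLessThan)
  qed
  have ab: "0 \<le> a j" "0 \<le> b j" if "j \<in> J" for j
  proof -
    show "0 \<le> a j" using h[OF that] pos by (simp add: a_def)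
    have "continuous_on {c j - h j..c j + h j} (\<lambda>y. \<bar>u y\<bar> / H)"
      by (intro continuous_intros continuous_on_subset[OF u_cont Icc[OF that]]) (use pos in auto)
    then show "0 \<le> b j"
      unfolding b_def using pos by (intro integral_nonneg integrable_continuous_real) auto
  qed
  let ?B = "\<lambda>j. integral {c j - h j..c j + h j} (\<lambda>y. (1 - ((y - c j) / h j)\<^sup>2) * u y)"
  have b_le: "H * (\<gamma> * b j) \<le> 3 * \<bar>\<gamma> * ?B j\<bar>" if "j \<in> J" for j
  proof -
    have "H * b j = integral {c j - h j..c j + h j} (\<lambda>y. \<bar>u y\<bar>)"
      using pos by (simp add: b_def)
    also have "\<dots> \<le> 3 * \<bar>?B j\<bar>"
      by (rule parabola_weight_lower_bound[OF h[OF that] continuous_on_subset[OF u_cont Icc[OF that]] half[OF that]])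
    finally show ?thesis using \<gamma> by (simp add: abs_mult mult.left_commute)
  qed
  \<comment> \<open>9 = 3 * 3: one factor from the parabola weight in \<open>b_le\<close>, one from
    the total energy.\<close>
  have finite_sum: "(\<Sum>j\<in>F. a j * b j) \<le> 9 * M / \<gamma> * V" if "finite F" "F \<subseteq> J" for F
  proof -
    have "H * \<gamma> * (\<Sum>j\<in>F. a j * b j) = (\<Sum>j\<in>F. a j * (H * (\<gamma> * b j)))"
      by (simp add: sum_distrib_left algebra_simps)
    also have "\<dots> \<le> (\<Sum>j\<in>F. a j * (3 * \<bar>\<gamma> * ?B j\<bar>))"
      using that by (intro sum_mono mult_left_mono b_le ab) auto
    also have "\<dots> = 3 * (\<Sum>j\<in>F. a j * \<bar>\<gamma> * ?B j\<bar>)" by (simp add: sum_distrib_left algebra_simps)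
    also have "(\<Sum>j\<in>F. a j * \<bar>\<gamma> * ?B j\<bar>) \<le> M * (3 * front.rate)"
      unfolding a_def \<gamma>_def
    proof (rule front.intervals_flux_bound[OF M f_bounds(2) f'(2) G(1) that(1)])
      show "disjoint_family_on (\<lambda>j. {c j - h j<..<c j + h j}) F"
        using disj that(2) by (auto simp: disjoint_family_on_def)
    qed (use that(2) h Icc in auto)
    finally have "H * (\<gamma> * (\<Sum>j\<in>F. a j * b j)) \<le> H * (9 * M * V)" by (simp add: V algebra_simps)
    then have "\<gamma> * (\<Sum>j\<in>F. a j * b j) \<le> 9 * M * V" using pos by simp
    then show ?thesis using \<gamma> by (simp add: field_simps)
  qed
  \<comment> \<open>The uniform bound on finite sums of nonnegative terms gives summability, so the
    infinite sum is not a default value and inherits the bound.\<close>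
  have "(\<lambda>j. a j * b j) summable_on J"
  proof (rule nonneg_bdd_above_summable_on)
    show "bdd_above (sum (\<lambda>j. a j * b j) ` {F. F \<subseteq> J \<and> finite F})"
      by (rule bdd_aboveI2[where M="9 * M / \<gamma> * V"]) (use finite_sum in auto)
  qed (use ab in auto)
  then have sum: "(\<Sum>\<^sub>\<infinity>j\<in>J. a j * b j) \<le> 9 * M / \<gamma> * V"
    by (rule infsum_le_finite_sums) (rule finite_sum)
  have "v0 \<le> M / \<gamma> * V" using laminar \<gamma> by (simp add: field_simps)
  then have "v0 + (\<Sum>\<^sub>\<infinity>j\<in>J. a j * b j) \<le> 10 * (M / \<gamma> * V)" using sum by simp
  then have "\<gamma> / (10 * M) * (v0 + (\<Sum>\<^sub>\<infinity>j\<in>J. a j * b j)) \<le> \<gamma> / (10 * M) * (10 * (M / \<gamma> * V))"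
    using M \<gamma> by (intro mult_left_mono) auto
  also have "\<dots> = V" using M \<gamma> by (simp add: field_simps)
  finally show ?thesis by (simp add: \<gamma>_def a_def b_def V_def)
qed

theorem theorem3:
  fixes f :: "real \<Rightarrow> real"
  assumes "C1_on 0 1 f"
    and "\<exists>s\<in>{0..1}. f s \<noteq> 0"
    and "f 0 = 0" and "f 1 = 0"
    and "\<forall>s\<in>{0<..<1}. f s \<ge> 0"
  shows "\<exists>C>0. \<forall>(\<kappa>::real) (v0::real) (H::real) (u::real \<Rightarrow> real)
            (T0::real \<Rightarrow> real \<Rightarrow> real) (T::real \<Rightarrow> real \<Rightarrow> real \<Rightarrow> real).
           \<kappa> > 0 \<and> v0 > 0 \<and> H > 0 \<and>
           C1_on 0 H u \<and> integral {0..H} u = 0 \<and>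
           admissible_initial_data \<kappa> v0 H f u T0 \<and>
           reactive_solution \<kappa> v0 H f u T0 T \<longrightarrow>
           (\<forall>(J::nat set) (c::nat \<Rightarrow> real) (h::nat \<Rightarrow> real).
              admissible_intervals H u J c h \<longrightarrow>
              (\<forall>t>0. bulk_burning_rate H T t \<ge>
                 C * (v0 + (\<Sum>\<^sub>\<infinity>j\<in>J. inverse (1 + (\<kappa> / v0) / h j) *
                              integral {c j - h j..c j + h j} (\<lambda>y. \<bar>u y\<bar> / H)))))"
proof -
  obtain f' where f'c: "continuous_on {0..1} f'"
    and fd: "\<forall>s\<in>{0..1}. (f has_real_derivative f' s) (at s within {0..1})"
    using assms(1) unfolding C1_on_def by blast
  have fc: "continuous_on {0..1} f" using fd by (intro DERIV_continuous_on) auto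
  have f0: "0 \<le> f s" if "s \<in> {0..1}" for s
    using assms(3-5) that by (cases "s = 0 \<or> s = 1") auto
  obtain B where B: "\<And>s. s \<in> {0..1} \<Longrightarrow> \<bar>f s\<bar> \<le> B"
    using continuous_on_Icc_bounded[OF fc] by blast
  obtain B' where B': "\<And>s. s \<in> {0..1} \<Longrightarrow> \<bar>f' s\<bar> \<le> B'"
    using continuous_on_Icc_bounded[OF f'c] by blast
  \<comment> \<open>One constant bounds \<open>f\<close> and \<open>\<bar>f' s\<bar>\<close>; being
    at least 1, it also absorbs the dissipation term left without a factor by AM-GM.\<close>
  define M where "M = max 1 (max B B')"
  have M: "1 \<le> M" "f s \<le> M" "\<bar>f' s\<bar> \<le> M" if "s \<in> {0..1}" for s
    using B[OF that] B'[OF that] by (auto simp: M_def)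
  define G where "G s = integral {0..s} f" for s
  have G: "(G has_real_derivative f s) (at s within {0..1})" if "s \<in> {0..1}" for s
    unfolding G_def by (rule integral_has_real_derivative[OF fc that])
  \<comment> \<open>A continuous nonnegative function with zero integral vanishes identically. Here
    f \<noteq> 0 enters, and it is what makes the final constant positive.\<close>
  have "integral {0..1} f \<noteq> 0"
    using integral_eq_0_iff[OF fc _ f0] assms(2) by auto
  moreover have "0 \<le> integral {0..1} f"
    by (intro integral_nonneg integrable_continuous_real fc f0)
  ultimately have G01: "G 0 < G 1" by (simp add: G_def)
  have "0 < (G 1 - G 0) / (10 * M)" using G01 M(1)[of 0] by simp
  moreover have "(G 1 - G 0) / (10 * M) * (v0 + (\<Sum>\<^sub>\<infinity>j\<in>J. inverse (1 + (\<kappa> / v0) / h j) *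
            integral {c j - h j..c j + h j} (\<lambda>y. \<bar>u y\<bar> / H))) \<le> bulk_burning_rate H T t"
    if "\<kappa> > 0 \<and> v0 > 0 \<and> H > 0 \<and> C1_on 0 H u \<and> integral {0..H} u = 0 \<and>
        admissible_initial_data \<kappa> v0 H f u T0 \<and> reactive_solution \<kappa> v0 H f u T0 T"
      "admissible_intervals H u J c h" "0 < t" for \<kappa> v0 H u T0 T J c h t
    using that
    by (intro bulk_burning_rate_bound[OF fd[rule_format] f'c M(3) f0 M(2) assms(3,4) M(1)[of 0] G G01]) auto
  ultimately show ?thesis by blast
qed

end
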